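(* Let $\theta$ and $\alpha$ be inner functions and let $D\in\mathcal{B}(K_\theta^\perp,K_\alpha^\perp)$. Then $D$ is an asymmetric dual truncated Toeplitz operator, i.e. $D\in\mathcal{T}(K_\theta^\perp,K_\alpha^\perp)$, if and only if all of the following conditions hold: (1) $P_{\alpha H^2}D_{|\theta H^2}=\hat{T}^\alpha_{\bar z}\,\big(P_{\alpha H^2}D_{|\theta H^2}\big)\,\hat{T}^\theta_z$; (2) $P^-D_{|H^2_-}=(P^-C_\alpha M_{\bar\theta})_{|\theta H^2}\,\big(P_{\alpha H^2}D_{|\theta H^2}\big)^*\,(M_\theta C_\alpha)_{|H^2_-}$; (3) $\big(P^-D_{|\theta H^2}\big)\hat{T}^\theta_z=\check{T}_z\,\big(P^-D_{|\theta H^2}\big)$ and $\big(P_{\alpha H^2}D_{|H^2_-}\big)^*\hat{T}^\alpha_z=\check{T}_z\,\big(P_{\alpha H^2}D_{|H^2_-}\big)^*$; (4) $P^-(D(\theta))=P^-\big(\theta\alpha\overline{D^*(\alpha)}\big)$ and $P^-(D^*(\alpha))=P^-\big(\theta\alpha\overline{D(\theta)}\big)$. In that case $D=D^{\theta,\alpha}_\varphi$ with $\varphi\in L^\infty$ given by $$\varphi=\bar\theta\,P_{\alpha H^2}(D(\theta))+\alpha\,\overline{P_{\theta H^2}(D^*(\alpha))}-\alpha\,\overline{\langle D^*(\alpha),\theta\rangle\,\theta}.$$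
   Context: $L^2=L^2(\mathbb{T},m)$ with $m$ normalized Lebesgue measure on the unit circle $\mathbb{T}$; $H^2\subset L^2$ is the Hardy space and $H^2_-=L^2\ominus H^2=\overline{zH^2}$. $P^-$ is the orthogonal projection of $L^2$ onto $H^2_-$. For an inner function $\theta$, $K_\theta=H^2\ominus\theta H^2$ (so $K_\theta=\{0\}$ for constant $\theta$), and $K_\theta^\perp=L^2\ominus K_\theta=\theta H^2\oplus H^2_-$. $P_{\theta H^2}$ and $P_\theta^\perp$ are the orthogonal projections of $L^2$ onto $\theta H^2$ and $K_\theta^\perp$. $M_\varphi$ denotes multiplication by $\varphi$. $\mathcal{B}(\mathcal{H},\mathcal{K})$ denotes bounded linear operators from $\mathcal{H}$ to $\mathcal{K}$. For $\varphi\in L^2$, $D^{\theta,\alpha}_\varphi$ is defined on $K_\theta^\perp\cap L^\infty$ (dense in $K_\theta^\perp$) by $D^{\theta,\alpha}_\varphi f=P_\alpha^\perp(\varphi f)$. If it extends to a bounded operator $K_\theta^\perp\to K_\alpha^\perp$ (this happens if and only if $\varphi\in L^\infty$), it is called an asymmetric dual truncated Toeplitz operator; $\mathcal{T}(K_\theta^\perp,K_\alpha^\perp)$ is the set of all such bounded operators. The operators $P_{\alpha H^2}D_{|\theta H^2}:\theta H^2\to\alpha H^2$, $P_{\alpha H^2}D_{|H^2_-}:H^2_-\to\alpha H^2$, $P^-D_{|\theta H^2}:\theta H^2\to H^2_-$, $P^-D_{|H^2_-}:H^2_-\to H^2_-$ are the entries of $D$ with respect to $K_\theta^\perp=\theta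 H^2\oplus H^2_-$ and $K_\alpha^\perp=\alpha H^2\oplus H^2_-$; adjoints of these entries are taken between the indicated spaces. For $\varphi\in L^\infty$: $\hat{T}^\theta_\varphi=P_{\theta H^2}M_{\varphi|\theta H^2}:\theta H^2\to\theta H^2$ and $\check{T}_\varphi=P^-M_{\varphi|H^2_-}:H^2_-\to H^2_-$. $C_\alpha$ is the antilinear map on $L^2$ given by $C_\alpha f=\alpha\bar z\bar f$. Here $z$ denotes the coordinate function on $\mathbb{T}$. *)

theory Defs
  imports "HOL-Analysis.Analysis"
begin

section \<open>Functions on the unit circle modulo null sets\<close>

text \<open>
  Normalized Lebesgue measure on the unit circle is realized as a Borel measure on the whole
  complex plane, the push-forward of the uniform distribution on the parameter interval under
  \<open>t \<mapsto> exp (i t)\<close>. The complement of the unit circle is a null set, so values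
  off the circle are irrelevant.
\<close>

definition circle_measure :: "complex measure" where
  "circle_measure = distr (uniform_measure lborel {0..2 * pi}) borel cis"

lemma sets_circle_measure [measurable_cong]: "sets circle_measure = sets borel"
  by (simp add: circle_measure_def)

lemma space_circle_measure: "space circle_measure = UNIV"
  by (simp add: circle_measure_def)

lemma measurable_cis_borel [measurable]: "cis \<in> borel_measurable borel"
  by (intro borel_measurable_continuous_onI continuous_intros)

lemma measurable_cnj_borel [measurable]: "cnj \<in> borel_measurable borel"
  by (intro borel_measurable_continuous_onI continuous_intros)

lemma emeasure_circle_measure_UNIV: "emeasure circle_measure UNIV = 1"
proof -
  have "cis \<in> borel_measurable (uniform_measure lborel {0..2 * pi})"
    by measurable
  then show ?thesis
    by (simp add: circle_measure_def emeasure_distr emeasure_uniform_measure ennreal_divide_self)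
qed

text \<open>
  All measurable functions modulo almost everywhere equality. Working in this ring keeps
  products and complex conjugates total; $L^2$, $L^\infty$ and the Hardy spaces are subsets of it.
\<close>

quotient_type circle_fun = "complex \<Rightarrow> complex" / partial:
  "\<lambda>f g. f \<in> borel_measurable circle_measure \<and> g \<in> borel_measurable circle_measure \<and>
     (AE w in circle_measure. f w = g w)"
proof (rule part_equivpI)
  show "\<exists>f. f \<in> borel_measurable circle_measure \<and> f \<in> borel_measurable circle_measure \<and>
          (AE w in circle_measure. f w = (f w :: complex))"
    by (rule exI[of _ "\<lambda>_. 0"]) simp
qed (auto intro!: sympI transpI)

instantiation circle_fun :: comm_ring_1
begin

lift_definition zero_circle_fun :: circle_fun is "\<lambda>_. 0" by simp

lift_definition one_circle_fun :: circle_fun is "\<lambda>_. 1" by simp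

lift_definition plus_circle_fun :: "circle_fun \<Rightarrow> circle_fun \<Rightarrow> circle_fun" is "\<lambda>f g w. f w + g w"
  by auto

lift_definition times_circle_fun :: "circle_fun \<Rightarrow> circle_fun \<Rightarrow> circle_fun" is "\<lambda>f g w. f w * g w"
  by auto

lift_definition uminus_circle_fun :: "circle_fun \<Rightarrow> circle_fun" is "\<lambda>f w. - f w"
  by auto

lift_definition minus_circle_fun :: "circle_fun \<Rightarrow> circle_fun \<Rightarrow> circle_fun" is "\<lambda>f g w. f w - g w"
  by auto

instance
proof
  show "(0::circle_fun) \<noteq> 1"
  proof (transfer, clarsimp)
    assume "AE w in circle_measure. False"
    then show False
      using emeasure_circle_measure_UNIV
      by (simp add: AE_iff_null space_circle_measure null_sets_def)
  qed
qed (transfer; auto simp: algebra_simps)+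

end

lift_definition cconj :: "circle_fun \<Rightarrow> circle_fun" is "\<lambda>f w. cnj (f w)"
  by (auto intro: measurable_compose[OF _ measurable_cnj_borel])

lift_definition cscale :: "complex \<Rightarrow> circle_fun \<Rightarrow> circle_fun" is "\<lambda>c f w. c * f w"
  by auto

lift_definition coord :: circle_fun is "\<lambda>w. w"
  by simp

lift_definition circle_integral :: "circle_fun \<Rightarrow> complex" is "\<lambda>f. integral\<^sup>L circle_measure f"
  by (auto intro: integral_cong_AE)

lift_definition square_integrable :: "circle_fun \<Rightarrow> bool" is
  "\<lambda>f. integrable circle_measure (\<lambda>w. (cmod (f w))\<^sup>2)"
  by (intro integrable_cong_AE) auto

lift_definition ess_bounded :: "circle_fun \<Rightarrow> bool" is
  "\<lambda>f. \<exists>C::real. AE w in circle_measure. cmod (f w) \<le> C"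
proof -
  fix f g :: "complex \<Rightarrow> complex"
  assume "f \<in> borel_measurable circle_measure \<and> g \<in> borel_measurable circle_measure \<and>
    (AE w in circle_measure. f w = g w)"
  then have "AE w in circle_measure. cmod (f w) = cmod (g w)"
    by auto
  then have "(AE w in circle_measure. cmod (f w) \<le> C) \<longleftrightarrow> (AE w in circle_measure. cmod (g w) \<le> C)" for C
    by (intro eventually_subst) (auto elim: eventually_mono)
  then show "(\<exists>C. AE w in circle_measure. cmod (f w) \<le> C) \<longleftrightarrow> (\<exists>C. AE w in circle_measure. cmod (g w) \<le> C)"
    by simp
qed

lift_definition unimodular :: "circle_fun \<Rightarrow> bool" is
  "\<lambda>f. AE w in circle_measure. cmod (f w) = 1"
  by (intro eventually_subst) (auto elim: eventually_mono)


section \<open>Function spaces\<close>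

definition L2 :: "circle_fun set" where
  "L2 = {f. square_integrable f}"

definition Linf :: "circle_fun set" where
  "Linf = {f. ess_bounded f}"

text \<open>Meaningful on \<open>L2\<close>; linear in the first argument.\<close>

definition ip :: "circle_fun \<Rightarrow> circle_fun \<Rightarrow> complex" where
  "ip f g = circle_integral (f * cconj g)"

definition l2norm :: "circle_fun \<Rightarrow> real" where
  "l2norm f = sqrt (Re (ip f f))"

text \<open>On the circle \<open>cconj coord ^ n\<close> is $z^{-n}$, so the Fourier coefficients of negative index vanish.\<close>

definition H2 :: "circle_fun set" where
  "H2 = {f \<in> L2. \<forall>n>0. ip f (cconj coord ^ n) = 0}"

definition ominus :: "circle_fun set \<Rightarrow> circle_fun set \<Rightarrow> circle_fun set" (infixl "\<ominus>" 65) where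
  "M \<ominus> N = {f \<in> M. \<forall>g\<in>N. ip f g = 0}"

definition H2m :: "circle_fun set" where
  "H2m = L2 \<ominus> H2"

definition inner_function :: "circle_fun \<Rightarrow> bool" where
  "inner_function \<theta> \<longleftrightarrow> \<theta> \<in> H2 \<inter> Linf \<and> unimodular \<theta>"

definition mulH2 :: "circle_fun \<Rightarrow> circle_fun set" where
  "mulH2 \<theta> = (\<lambda>h. \<theta> * h) ` H2"

definition model_space :: "circle_fun \<Rightarrow> circle_fun set" where
  "model_space \<theta> = H2 \<ominus> mulH2 \<theta>"

definition Kperp :: "circle_fun \<Rightarrow> circle_fun set" where
  "Kperp \<theta> = L2 \<ominus> model_space \<theta>"


section \<open>Operators\<close>

text \<open>
  An operator from a subspace \<open>M\<close> to a subspace \<open>N\<close> is a total function of which only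
  the values on \<open>M\<close> matter; two operators on \<open>M\<close> are compared with \<open>eq_on M\<close>.
\<close>

definition eq_on :: "circle_fun set \<Rightarrow> (circle_fun \<Rightarrow> circle_fun) \<Rightarrow> (circle_fun \<Rightarrow> circle_fun) \<Rightarrow> bool" where
  "eq_on M S T \<longleftrightarrow> (\<forall>f\<in>M. S f = T f)"

definition bounded_ops :: "circle_fun set \<Rightarrow> circle_fun set \<Rightarrow> (circle_fun \<Rightarrow> circle_fun) set" where
  "bounded_ops M N = {T. (\<forall>f\<in>M. T f \<in> N) \<and>
     (\<forall>f\<in>M. \<forall>g\<in>M. T (f + g) = T f + T g) \<and>
     (\<forall>c. \<forall>f\<in>M. T (cscale c f) = cscale c (T f)) \<and>
     (\<exists>C. \<forall>f\<in>M. l2norm (T f) \<le> C * l2norm f)}"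

text \<open>Orthogonal projection of \<open>L2\<close> onto a closed subspace \<open>M\<close>.\<close>

definition proj :: "circle_fun set \<Rightarrow> circle_fun \<Rightarrow> circle_fun" where
  "proj M f = (THE g. g \<in> M \<and> (\<forall>h\<in>M. ip (f - g) h = 0))"

text \<open>
  Adjoint of an operator \<open>T\<close> with domain \<open>M\<close>. For \<open>T\<close> mapping \<open>M\<close> to \<open>N\<close> it is an operator
  from \<open>N\<close> to \<open>M\<close>; the defining equation does not mention \<open>N\<close>.
\<close>

definition adj :: "circle_fun set \<Rightarrow> (circle_fun \<Rightarrow> circle_fun) \<Rightarrow> circle_fun \<Rightarrow> circle_fun" where
  "adj M T g = (THE h. h \<in> M \<and> (\<forall>f\<in>M. ip (T f) g = ip f h))"

definition Mul :: "circle_fun \<Rightarrow> circle_fun \<Rightarrow> circle_fun" where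
  "Mul \<phi> f = \<phi> * f"

definition Conj :: "circle_fun \<Rightarrow> circle_fun \<Rightarrow> circle_fun" where
  "Conj \<alpha> f = \<alpha> * cconj coord * cconj f"

definition That :: "circle_fun \<Rightarrow> circle_fun \<Rightarrow> circle_fun \<Rightarrow> circle_fun" where
  "That \<theta> \<phi> = proj (mulH2 \<theta>) \<circ> Mul \<phi>"

definition Tcheck :: "circle_fun \<Rightarrow> circle_fun \<Rightarrow> circle_fun" where
  "Tcheck \<phi> = proj H2m \<circ> Mul \<phi>"

text \<open>
  For \<open>\<phi>\<close> in \<open>L2\<close> this is meaningful on \<open>Kperp \<theta> \<inter> Linf\<close>; for \<open>\<phi>\<close> in \<open>Linf\<close> the same formula
  gives the bounded extension to all of \<open>Kperp \<theta>\<close>. The domain parameter \<open>\<theta>\<close> does not enter the formula.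
\<close>

definition adtt :: "circle_fun \<Rightarrow> circle_fun \<Rightarrow> circle_fun \<Rightarrow> circle_fun" where
  "adtt \<alpha> \<phi> = proj (Kperp \<alpha>) \<circ> Mul \<phi>"

definition ADTT :: "circle_fun \<Rightarrow> circle_fun \<Rightarrow> (circle_fun \<Rightarrow> circle_fun) set" where
  "ADTT \<theta> \<alpha> = {D \<in> bounded_ops (Kperp \<theta>) (Kperp \<alpha>).
     \<exists>\<phi>\<in>L2. eq_on (Kperp \<theta> \<inter> Linf) D (adtt \<alpha> \<phi>)}"

end

theory Submission
  imports Defs
begin

text \<open>
  The whole proof is about the sesquilinear form \<open>b f g = ip (D f) g\<close>. If \<open>D\<close> is compression of
  multiplication by \<open>\<phi>\<close>, then \<open>b f g\<close> is the integral of \<open>\<phi> * f * cconj g\<close>, so it depends only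
  on the product \<open>f * cconj g\<close>. Each of the characterizing identities, paired with test functions, says
  that \<open>b\<close> takes equal values at two particular pairs with the same product
  (\<open>shift_invariance_iff\<close>, \<open>reflection_symmetry_iff\<close>, \<open>row_shift_iff\<close>, \<open>column_shift_iff\<close>,
  \<open>theta_row_iff\<close>, \<open>alpha_column_iff\<close>). Necessity is then
  immediate once a symbol in \<open>L2\<close> is known to be bounded and to represent \<open>D\<close> on the
  whole space and not only on bounded functions (\<open>ADTT_symbol\<close>).

  For sufficiency, split \<open>b\<close> into four blocks according to
  \<open>Kperp \<theta> = mulH2 \<theta> \<oplus> H2m\<close> and \<open>Kperp \<alpha> = mulH2 \<alpha> \<oplus> H2m\<close>. Shift invariance makes the matrix of the
  block \<open>mulH2 \<theta> \<times> mulH2 \<alpha>\<close> in the bases \<open>\<theta> * coord ^ i\<close>, \<open>\<alpha> * coord ^ j\<close> a Toeplitz matrix. Its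
  first row is read off from \<open>D \<theta>\<close> and its first column from the adjoint at \<open>\<alpha>\<close>, and
  these are the Fourier coefficients of the function \<open>symbol\<close> after multiplication by
  \<open>cconj \<alpha> * \<theta>\<close>; the last summand in its definition removes the diagonal entry that is counted
  twice (\<open>symbol_entries\<close>). As in the Brown-Halmos theorem, boundedness of \<open>D\<close> on this block alone
  makes the symbol essentially bounded (\<open>toeplitz_symbol_bounded\<close>). The other blocks follow
  from this one: the reflection symmetry carries \<open>H2m \<times> H2m\<close> into it, the conditions on
  \<open>D \<theta>\<close> and on the adjoint at \<open>\<alpha>\<close> determine the row of \<open>\<theta>\<close> and the column of \<open>\<alpha>\<close> in the mixed blocks,
  and the intertwining relations with the shift propagate these to all rows and columns.

  The analytic input consists of two facts. First, \<open>L2\<close> is complete, hence every bounded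
  functional on an orthogonal complement in \<open>L2\<close> is represented by a vector of it
  (\<open>riesz_representation\<close>); all spaces involved are such complements, so projections and
  adjoints exist. Second, a function whose Toeplitz form is bounded on analytic polynomials is
  essentially bounded (\<open>bounded_of_toeplitz_form\<close>), which follows from the Stone-Weierstrass theorem and
  inner regularity; the bound zero gives uniqueness of Fourier coefficients.
\<close>

section \<open>Representatives of functions on the circle\<close>

abbreviation rep :: "circle_fun \<Rightarrow> complex \<Rightarrow> complex" where
  "rep \<equiv> rep_circle_fun"

text \<open>
  The ring operations are determined by representatives up to null sets, so every statement about
  integrals becomes one about measurable functions that holds almost everywhere.
\<close>

lemma rep_measurable [measurable]: "rep f \<in> borel_measurable circle_measure"
  using Quotient_rep_reflp[OF Quotient_circle_fun, of f] by blast

lemma rep_eqI: "(AE w in circle_measure. rep f w = rep g w) \<Longrightarrow> f = g"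
  using Quotient_rel_rep[OF Quotient_circle_fun, of f g] by auto

lemma rep_abs:
  assumes "f \<in> borel_measurable circle_measure"
  shows "AE w in circle_measure. rep (abs_circle_fun f) w = f w"
  using Quotient_rep_abs[OF Quotient_circle_fun, of f] assms by auto

lemma rep_zero: "AE w in circle_measure. rep 0 w = 0"
  unfolding zero_circle_fun_def by (rule rep_abs) simp

lemma rep_one: "AE w in circle_measure. rep 1 w = 1"
  unfolding one_circle_fun_def by (rule rep_abs) simp

lemma rep_coord: "AE w in circle_measure. rep coord w = w"
  unfolding coord_def by (rule rep_abs) simp

lemma rep_add: "AE w in circle_measure. rep (f + g) w = rep f w + rep g w"
  unfolding plus_circle_fun_def map_fun_def o_def id_def by (rule rep_abs) simp

lemma rep_mult: "AE w in circle_measure. rep (f * g) w = rep f w * rep g w"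
  unfolding times_circle_fun_def map_fun_def o_def id_def by (rule rep_abs) simp

lemma rep_diff: "AE w in circle_measure. rep (f - g) w = rep f w - rep g w"
  unfolding minus_circle_fun_def map_fun_def o_def id_def by (rule rep_abs) simp

lemma rep_cconj: "AE w in circle_measure. rep (cconj f) w = cnj (rep f w)"
  unfolding cconj_def map_fun_def o_def id_def
  by (rule rep_abs) (auto intro: measurable_compose[OF _ measurable_cnj_borel])

lemma rep_cscale: "AE w in circle_measure. rep (cscale c f) w = c * rep f w"
  unfolding cscale_def map_fun_def o_def id_def by (rule rep_abs) simp

lemma circle_integral_rep: "circle_integral f = integral\<^sup>L circle_measure (rep f)"
  unfolding circle_integral_def map_fun_def o_def id_def by simp

lemma L2_rep: "f \<in> L2 \<longleftrightarrow> integrable circle_measure (\<lambda>w. (cmod (rep f w))\<^sup>2)"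
  unfolding L2_def square_integrable_def map_fun_def o_def id_def by simp

lemma Linf_rep: "f \<in> Linf \<longleftrightarrow> (\<exists>C. AE w in circle_measure. cmod (rep f w) \<le> C)"
  unfolding Linf_def ess_bounded_def map_fun_def o_def id_def by simp

lemma unimodular_rep: "unimodular f \<longleftrightarrow> (AE w in circle_measure. cmod (rep f w) = 1)"
  unfolding unimodular_def map_fun_def o_def id_def by simp

lemma finite_circle_measure: "finite_measure circle_measure"
  by (rule finite_measureI) (simp add: emeasure_circle_measure_UNIV space_circle_measure)

lemma integrable_circle_const [simp]: "integrable circle_measure (\<lambda>_. c :: 'b :: {banach, second_countable_topology})"
  by (rule finite_measure.integrable_const[OF finite_circle_measure])

lemma cconj_simps [simp]:
  "cconj (cconj f) = f" "cconj (f * g) = cconj f * cconj g" "cconj (f + g) = cconj f + cconj g"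
  "cconj (f - g) = cconj f - cconj g" "cconj 0 = 0" "cconj 1 = 1"
  "cconj (cscale c f) = cscale (cnj c) (cconj f)"
  by (transfer, auto intro: measurable_compose[OF _ measurable_cnj_borel])+

lemma cconj_power [simp]: "cconj (f ^ n) = cconj f ^ n"
  by (induction n) auto

lemma cscale_mult: "cscale c f * g = cscale c (f * g)" "f * cscale c g = cscale c (f * g)"
  by (transfer, auto simp: mult_ac)+

lemma cscale_one [simp]: "cscale 1 f = f"
  by transfer auto

lemma cscale_minus_one: "cscale (-1) f = - f"
  by transfer auto

lemma cscale_cscale: "cscale a (cscale b f) = cscale (a * b) f"
  by transfer (auto simp: mult_ac)

lemma AE_on_circle: "AE w in circle_measure. cmod w = 1"
  unfolding circle_measure_def by (subst AE_distr_iff) auto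

lemma unimodular_coord: "unimodular coord"
  unfolding unimodular_rep using rep_coord AE_on_circle by eventually_elim simp

lemma unimodular_cconj: "unimodular f \<Longrightarrow> unimodular (cconj f)"
  unfolding unimodular_rep using rep_cconj[of f] by (auto elim!: eventually_elim2)

lemma unimodular_mult:
  assumes "unimodular f" "unimodular g" shows "unimodular (f * g)"
  using rep_mult[of f g] assms unfolding unimodular_rep by eventually_elim (simp add: norm_mult)

lemma unimodular_one: "unimodular 1"
  unfolding unimodular_rep using rep_one by eventually_elim simp

lemma unimodular_power: "unimodular f \<Longrightarrow> unimodular (f ^ n)"
  by (induction n) (auto intro: unimodular_mult unimodular_one)

lemma unimodular_cancel:
  assumes "unimodular f" shows "f * cconj f = 1" "cconj f * f = 1"
proof -
  show "f * cconj f = 1"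
  proof (rule rep_eqI)
    show "AE w in circle_measure. rep (f * cconj f) w = rep 1 w"
      using rep_mult[of f "cconj f"] rep_cconj[of f] rep_one assms[unfolded unimodular_rep]
      by eventually_elim (simp add: complex_norm_square[symmetric])
  qed
  then show "cconj f * f = 1" by (simp add: mult.commute)
qed

lemma unimodular_Linf: "unimodular f \<Longrightarrow> f \<in> Linf"
  unfolding unimodular_rep Linf_rep by (auto intro!: exI[of _ 1] elim: eventually_mono)

lemma Linf_mult_L2:
  assumes "\<phi> \<in> Linf" "f \<in> L2" shows "\<phi> * f \<in> L2"
proof -
  obtain C where C: "AE w in circle_measure. cmod (rep \<phi> w) \<le> C"
    using assms(1) unfolding Linf_rep by blast
  show ?thesis unfolding L2_rep
  proof (rule Bochner_Integration.integrable_bound)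
    show "integrable circle_measure (\<lambda>w. C\<^sup>2 * (cmod (rep f w))\<^sup>2)"
      using assms(2) unfolding L2_rep by simp
    show "AE w in circle_measure. norm ((cmod (rep (\<phi> * f) w))\<^sup>2) \<le> norm (C\<^sup>2 * (cmod (rep f w))\<^sup>2)"
      using C rep_mult[of \<phi> f]
      by eventually_elim (auto simp: norm_mult power_mult_distrib intro!: mult_right_mono power_mono)
  qed measurable
qed

lemma L2_cconj: "f \<in> L2 \<Longrightarrow> cconj f \<in> L2"
  unfolding L2_rep
  by (erule integrable_cong_AE_imp) (use rep_cconj[of f] in \<open>auto elim: eventually_mono\<close>)

lemma L2_cscale: "f \<in> L2 \<Longrightarrow> cscale c f \<in> L2"
proof -
  assume "f \<in> L2"
  then have "integrable circle_measure (\<lambda>w. (cmod c)\<^sup>2 * (cmod (rep f w))\<^sup>2)"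
    unfolding L2_rep by simp
  then show ?thesis unfolding L2_rep
    by (rule integrable_cong_AE_imp)
      (use rep_cscale[of c f] in \<open>auto elim!: eventually_mono simp: norm_mult power_mult_distrib\<close>)
qed

lemma L2_add:
  assumes "f \<in> L2" "g \<in> L2" shows "f + g \<in> L2"
  unfolding L2_rep
proof (rule Bochner_Integration.integrable_bound)
  show "integrable circle_measure (\<lambda>w. 2 * (cmod (rep f w))\<^sup>2 + 2 * (cmod (rep g w))\<^sup>2)"
    using assms unfolding L2_rep by simp
  have "(cmod (a + b))\<^sup>2 \<le> 2 * (cmod a)\<^sup>2 + 2 * (cmod b)\<^sup>2" for a b
  proof -
    have "(cmod (a + b))\<^sup>2 \<le> (cmod a + cmod b)\<^sup>2" by (intro power_mono norm_triangle_ineq) auto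
    also have "\<dots> \<le> 2 * (cmod a)\<^sup>2 + 2 * (cmod b)\<^sup>2"
      using zero_le_power2[of "cmod a - cmod b"] by (simp add: power2_eq_square algebra_simps)
    finally show ?thesis .
  qed
  with rep_add[of f g] show "AE w in circle_measure. norm ((cmod (rep (f + g) w))\<^sup>2)
      \<le> norm (2 * (cmod (rep f w))\<^sup>2 + 2 * (cmod (rep g w))\<^sup>2)"
    by (auto elim!: eventually_mono)
qed measurable

lemma L2_uminus: "f \<in> L2 \<Longrightarrow> - f \<in> L2"
  using L2_cscale[of f "-1"] by (simp add: cscale_minus_one)

lemma L2_diff: "f \<in> L2 \<Longrightarrow> g \<in> L2 \<Longrightarrow> f - g \<in> L2"
  using L2_add[of f "- g"] L2_uminus[of g] by simp

lemma L2_zero: "0 \<in> L2"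
  unfolding L2_rep by (rule integrable_cong_AE_imp[of _ "\<lambda>_. 0"]) (use rep_zero in auto)

lemma Linf_L2: "f \<in> Linf \<Longrightarrow> f \<in> L2"
proof -
  have "1 \<in> L2" unfolding L2_rep
    by (rule integrable_cong_AE_imp[of _ "\<lambda>_. 1"]) (use rep_one in auto)
  then show "f \<in> Linf \<Longrightarrow> f \<in> L2" using Linf_mult_L2[of f 1] by simp
qed

lemma Linf_cconj:
  assumes "f \<in> Linf" shows "cconj f \<in> Linf"
proof -
  obtain C where "AE w in circle_measure. cmod (rep f w) \<le> C"
    using assms unfolding Linf_rep by blast
  with rep_cconj[of f] have "AE w in circle_measure. cmod (rep (cconj f) w) \<le> C"
    by eventually_elim simp
  then show ?thesis unfolding Linf_rep by blast
qed

lemma Linf_mult: "f \<in> Linf \<Longrightarrow> g \<in> Linf \<Longrightarrow> f * g \<in> Linf"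
proof -
  assume "f \<in> Linf" "g \<in> Linf"
  then obtain C E where "AE w in circle_measure. cmod (rep f w) \<le> C"
    "AE w in circle_measure. cmod (rep g w) \<le> E"
    unfolding Linf_rep by blast
  then have "AE w in circle_measure. cmod (rep (f * g) w) \<le> \<bar>C\<bar> * \<bar>E\<bar>"
    using rep_mult[of f g] by eventually_elim (auto simp: norm_mult intro!: mult_mono)
  then show ?thesis unfolding Linf_rep by blast
qed

section \<open>The inner product\<close>

lemma rep_ip: "ip f g = integral\<^sup>L circle_measure (\<lambda>w. rep f w * cnj (rep g w))"
  unfolding ip_def circle_integral_rep
  by (rule integral_cong_AE) (use rep_mult[of f "cconj g"] rep_cconj[of g] in \<open>auto elim: eventually_elim2\<close>)

lemma integrable_ip:
  assumes "f \<in> L2" "g \<in> L2"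
  shows "integrable circle_measure (\<lambda>w. rep f w * cnj (rep g w))"
proof (rule Bochner_Integration.integrable_bound)
  show "integrable circle_measure (\<lambda>w. (cmod (rep f w))\<^sup>2 + (cmod (rep g w))\<^sup>2)"
    using assms unfolding L2_rep by simp
  have "cmod (a * cnj b) \<le> (cmod a)\<^sup>2 + (cmod b)\<^sup>2" for a b
  proof -
    have "2 * (cmod a * cmod b) \<le> (cmod a)\<^sup>2 + (cmod b)\<^sup>2"
      using sum_squares_bound[of "cmod a" "cmod b"] by (simp add: mult.assoc)
    moreover have "0 \<le> cmod a * cmod b" by simp
    ultimately show ?thesis unfolding norm_mult complex_mod_cnj by linarith
  qed
  then show "AE w in circle_measure. norm (rep f w * cnj (rep g w))
      \<le> norm ((cmod (rep f w))\<^sup>2 + (cmod (rep g w))\<^sup>2)"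
    by auto
qed (auto intro!: borel_measurable_times measurable_compose[OF _ measurable_cnj_borel])

lemma ip_add_left: "f \<in> L2 \<Longrightarrow> g \<in> L2 \<Longrightarrow> h \<in> L2 \<Longrightarrow> ip (f + g) h = ip f h + ip g h"
proof -
  assume *: "f \<in> L2" "g \<in> L2" "h \<in> L2"
  have "ip (f + g) h = integral\<^sup>L circle_measure
      (\<lambda>w. rep f w * cnj (rep h w) + rep g w * cnj (rep h w))"
    unfolding rep_ip
    by (rule integral_cong_AE)
      (use rep_add[of f g] in \<open>auto elim!: eventually_mono simp: algebra_simps
        intro!: borel_measurable_add borel_measurable_times measurable_compose[OF _ measurable_cnj_borel]\<close>)
  also have "\<dots> = ip f h + ip g h" unfolding rep_ip
    by (rule Bochner_Integration.integral_add) (use * integrable_ip in auto)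
  finally show ?thesis .
qed

lemma ip_cnj: "cnj (ip f g) = ip g f"
  unfolding rep_ip Bochner_Integration.integral_cnj[symmetric] by (simp add: mult.commute)

lemma ip_eq_0_commute: "ip f g = 0 \<longleftrightarrow> ip g f = 0"
  by (simp add: ip_cnj[of f g, symmetric])

lemma ip_cscale_left: "ip (cscale c f) g = c * ip f g"
proof -
  have "ip (cscale c f) g = integral\<^sup>L circle_measure (\<lambda>w. c * (rep f w * cnj (rep g w)))"
    unfolding rep_ip
    by (rule integral_cong_AE)
      (use rep_cscale[of c f] in \<open>auto elim!: eventually_mono simp: algebra_simps
        intro!: borel_measurable_times measurable_compose[OF _ measurable_cnj_borel]\<close>)
  then show ?thesis by (simp add: rep_ip)
qed

lemma ip_cscale_right: "ip f (cscale c g) = cnj c * ip f g"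
  using ip_cscale_left[of c g f] by (metis complex_cnj_mult ip_cnj)

lemma ip_add_right: "f \<in> L2 \<Longrightarrow> g \<in> L2 \<Longrightarrow> h \<in> L2 \<Longrightarrow> ip h (f + g) = ip h f + ip h g"
  by (metis complex_cnj_add ip_add_left ip_cnj)

lemma ip_uminus_left: "ip (- f) g = - ip f g"
  using ip_cscale_left[of "-1" f g] by (simp add: cscale_minus_one)

lemma ip_uminus_right: "ip g (- f) = - ip g f"
  using ip_cscale_right[of g "-1" f] by (simp add: cscale_minus_one)

lemma ip_diff_left: "f \<in> L2 \<Longrightarrow> g \<in> L2 \<Longrightarrow> h \<in> L2 \<Longrightarrow> ip (f - g) h = ip f h - ip g h"
  using ip_add_left[of f "- g" h] by (simp add: L2_uminus ip_uminus_left)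

lemma ip_diff_right: "f \<in> L2 \<Longrightarrow> g \<in> L2 \<Longrightarrow> h \<in> L2 \<Longrightarrow> ip h (f - g) = ip h f - ip h g"
  using ip_add_right[of f "- g" h] by (simp add: L2_uminus ip_uminus_right)

lemma ip_zero_left [simp]: "ip 0 f = 0"
  using ip_uminus_left[of 0 f] by simp

lemma ip_zero_right [simp]: "ip f 0 = 0"
  using ip_uminus_right[of f 0] by simp

lemma ip_self: "ip f f = complex_of_real (integral\<^sup>L circle_measure (\<lambda>w. (cmod (rep f w))\<^sup>2))"
  unfolding rep_ip integral_complex_of_real[symmetric] by (simp only: complex_norm_square)

lemma l2norm_rep: "(l2norm f)\<^sup>2 = integral\<^sup>L circle_measure (\<lambda>w. (cmod (rep f w))\<^sup>2)"
  unfolding l2norm_def ip_self by (simp add: integral_nonneg_AE)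

lemma l2norm_ip: "ip f f = complex_of_real ((l2norm f)\<^sup>2)"
  by (simp add: ip_self l2norm_rep)

lemma l2norm_nonneg [simp]: "l2norm f \<ge> 0"
  unfolding l2norm_def ip_self by (simp add: integral_nonneg_AE)

lemma l2norm_eq_0:
  assumes "f \<in> L2" "ip f f = 0" shows "f = 0"
proof (rule rep_eqI)
  have "integral\<^sup>L circle_measure (\<lambda>w. (cmod (rep f w))\<^sup>2) = 0" using assms by (simp add: ip_self)
  then have "AE w in circle_measure. (cmod (rep f w))\<^sup>2 = 0"
    using assms integral_nonneg_eq_0_iff_AE[of circle_measure "\<lambda>w. (cmod (rep f w))\<^sup>2"]
    unfolding L2_rep by auto
  then show "AE w in circle_measure. rep f w = rep 0 w"
    using rep_zero by eventually_elim simp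
qed

text \<open>
  Both sides are the integral of the same element of the ring of measurable functions.
\<close>

lemma ip_move: "ip (a * b) c = ip b (cconj a * c)"
  unfolding ip_def by (simp add: mult_ac)

lemma ip_unimodular: "unimodular u \<Longrightarrow> ip (u * f) (u * g) = ip f g"
  unfolding ip_move by (simp add: mult.assoc[symmetric] unimodular_cancel)

lemma l2norm_unimodular: "unimodular u \<Longrightarrow> l2norm (u * f) = l2norm f"
  by (simp add: l2norm_def ip_unimodular)

text \<open>
  The discriminant inequality, including the degenerate case \<open>a = 0\<close>. It yields the
  Cauchy-Schwarz inequality and, with an error term \<open>e\<close> that tends to zero, the variational step in
  the Riesz representation theorem.
\<close>

lemma quadratic_nonneg_imp:
  fixes a b e :: real
  assumes "\<And>t. 0 \<le> a * t\<^sup>2 + 2 * b * t + e" "a \<ge> 0"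
  shows "b\<^sup>2 \<le> a * e"
proof (cases "a = 0")
  case True
  have "b = 0"
  proof (rule ccontr)
    assume "b \<noteq> 0"
    with assms(1)[of "- (e + 1) / (2 * b)"] True show False by (simp add: field_simps)
  qed
  then show ?thesis using True by simp
next
  case False
  with assms(2) have "a > 0" by simp
  have "0 \<le> a * (- b / a)\<^sup>2 + 2 * b * (- b / a) + e" by (rule assms(1))
  also have "\<dots> = e - b\<^sup>2 / a" using \<open>a > 0\<close> by (simp add: field_simps power2_eq_square)
  finally show ?thesis using \<open>a > 0\<close> by (simp add: field_simps)
qed

lemma l2norm_add_sq:
  assumes "f \<in> L2" "g \<in> L2"
  shows "(l2norm (f + g))\<^sup>2 = (l2norm f)\<^sup>2 + 2 * Re (ip f g) + (l2norm g)\<^sup>2"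
proof -
  have "complex_of_real ((l2norm (f + g))\<^sup>2) = ip f f + (ip f g + cnj (ip f g)) + ip g g"
    unfolding l2norm_ip[symmetric] ip_cnj using assms by (simp add: ip_add_left ip_add_right L2_add)
  also have "\<dots> = complex_of_real ((l2norm f)\<^sup>2 + 2 * Re (ip f g) + (l2norm g)\<^sup>2)"
    by (simp add: l2norm_ip complex_add_cnj)
  finally show ?thesis by (simp only: of_real_eq_iff)
qed

lemma l2norm_cscale: "l2norm (cscale c f) = cmod c * l2norm f"
proof -
  have "complex_of_real ((l2norm (cscale c f))\<^sup>2) = complex_of_real ((cmod c * l2norm f)\<^sup>2)"
    unfolding l2norm_ip[symmetric] ip_cscale_left ip_cscale_right
    by (simp add: l2norm_ip power_mult_distrib mult.assoc[symmetric] complex_norm_square mult.commute[of "cnj c"]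
      del: of_real_power)
  then show ?thesis
    by (simp only: of_real_eq_iff) (simp add: power2_eq_iff_nonneg)
qed

lemma l2norm_uminus [simp]: "l2norm (- f) = l2norm f"
  using l2norm_cscale[of "-1" f] by (simp add: cscale_minus_one)

lemma Re_ip_le:
  assumes "f \<in> L2" "g \<in> L2" shows "\<bar>Re (ip f g)\<bar> \<le> l2norm f * l2norm g"
proof -
  have "(Re (ip f g))\<^sup>2 \<le> (l2norm g)\<^sup>2 * (l2norm f)\<^sup>2"
  proof (rule quadratic_nonneg_imp)
    fix t :: real
    have "0 \<le> (l2norm (f + cscale t g))\<^sup>2" by simp
    also have "\<dots> = (l2norm f)\<^sup>2 + 2 * (t * Re (ip f g)) + t\<^sup>2 * (l2norm g)\<^sup>2"
      using assms by (simp add: l2norm_add_sq L2_cscale ip_cscale_right l2norm_cscale power_mult_distrib)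
    finally show "0 \<le> (l2norm g)\<^sup>2 * t\<^sup>2 + 2 * Re (ip f g) * t + (l2norm f)\<^sup>2" by (simp add: mult_ac)
  qed simp
  then have "(Re (ip f g))\<^sup>2 \<le> (l2norm f * l2norm g)\<^sup>2" by (simp add: power_mult_distrib mult.commute)
  then show ?thesis using abs_le_square_iff[of "Re (ip f g)" "l2norm f * l2norm g"] by simp
qed

lemma cauchy_schwarz:
  assumes "f \<in> L2" "g \<in> L2" shows "cmod (ip f g) \<le> l2norm f * l2norm g"
proof (cases "ip f g = 0")
  case False
  \<comment> \<open>A rotation that makes the inner product real and nonnegative.\<close>
  define c where "c = cnj (ip f g) / cmod (ip f g)"
  have "cmod c = 1" using False by (simp add: c_def norm_divide)
  have "c * ip f g = cmod (ip f g)"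
    using False by (simp add: c_def complex_norm_square[symmetric] mult.commute power2_eq_square field_simps
      flip: of_real_mult)
  then have "cmod (ip f g) = Re (ip (cscale c f) g)" by (simp add: ip_cscale_left)
  also have "\<dots> \<le> l2norm (cscale c f) * l2norm g"
    using Re_ip_le[OF L2_cscale[OF assms(1)] assms(2), of c] by simp
  finally show ?thesis using \<open>cmod c = 1\<close> by (simp add: l2norm_cscale)
qed simp

lemma l2norm_triangle:
  assumes "f \<in> L2" "g \<in> L2" shows "l2norm (f + g) \<le> l2norm f + l2norm g"
proof -
  have "(l2norm (f + g))\<^sup>2 \<le> (l2norm f + l2norm g)\<^sup>2"
    using Re_ip_le[OF assms] by (simp add: l2norm_add_sq[OF assms] power2_sum)
  then show ?thesis by (rule power2_le_imp_le) simp
qed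

section \<open>Completeness\<close>

text \<open>
  On a probability space the $L^1$ norm is at most the $L^2$ norm. It suffices to integrate the
  inequality \<open>2 * x \<le> t + x\<^sup>2 / t\<close>.
\<close>

lemma integral_cmod_le:
  assumes "f \<in> L2" "t > 0" "l2norm f \<le> t"
  shows "integral\<^sup>N circle_measure (\<lambda>w. ennreal (cmod (rep f w))) \<le> ennreal t"
proof -
  have int: "integrable circle_measure (\<lambda>w. (cmod (rep f w))\<^sup>2)" using assms(1) by (simp add: L2_rep)
  have "cmod (rep f w) \<le> (t + (cmod (rep f w))\<^sup>2 / t) / 2" for w
    using sum_squares_bound[of t "cmod (rep f w)"] assms(2) by (simp add: field_simps power2_eq_square)
  then have "integral\<^sup>N circle_measure (\<lambda>w. ennreal (cmod (rep f w)))
      \<le> integral\<^sup>N circle_measure (\<lambda>w. ennreal ((t + (cmod (rep f w))\<^sup>2 / t) / 2))"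
    by (intro nn_integral_mono ennreal_leI) auto
  also have "\<dots> = ennreal (integral\<^sup>L circle_measure (\<lambda>w. (t + (cmod (rep f w))\<^sup>2 / t) / 2))"
    by (rule nn_integral_eq_integral) (use int assms(2) in auto)
  also have "integral\<^sup>L circle_measure (\<lambda>w. (t + (cmod (rep f w))\<^sup>2 / t) / 2) = (t + (l2norm f)\<^sup>2 / t) / 2"
    using int by (simp add: l2norm_rep measure_def space_circle_measure emeasure_circle_measure_UNIV)
  also have "\<dots> \<le> t"
  proof -
    have "(l2norm f)\<^sup>2 \<le> t\<^sup>2" using assms by (intro power_mono) auto
    then show ?thesis using assms(2) by (simp add: field_simps power2_eq_square)
  qed
  finally show ?thesis by (simp add: ennreal_leI)
qed

text \<open>
  The geometric series of the increments, which makes the distance to any later term at most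
  \<open>2 * (1/2) ^ n\<close>.
\<close>

lemma l2norm_tail:
  assumes L2: "\<And>n. f n \<in> L2" and fast: "\<And>n. l2norm (f (Suc n) - f n) \<le> (1/2) ^ n"
  shows "l2norm (f (n + k) - f n) \<le> 2 * (1/2) ^ n"
proof -
  have "l2norm (f (n + k) - f n) \<le> 2 * (1/2) ^ n - 2 * (1/2) ^ (n + k)"
  proof (induction k)
    case (Suc k)
    have "f (n + Suc k) - f n = (f (Suc (n + k)) - f (n + k)) + (f (n + k) - f n)" by simp
    then have "l2norm (f (n + Suc k) - f n) \<le> l2norm (f (Suc (n + k)) - f (n + k)) + l2norm (f (n + k) - f n)"
      by (metis L2 L2_diff l2norm_triangle)
    also have "\<dots> \<le> (1/2) ^ (n + k) + (2 * (1/2) ^ n - 2 * (1/2) ^ (n + k))"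
      using fast[of "n + k"] Suc by (intro add_mono)
    finally show ?case by simp
  qed (simp add: l2norm_def)
  moreover have "(0::real) \<le> 2 * (1/2) ^ (n + k)" by simp
  ultimately show ?thesis by linarith
qed

text \<open>
  The Riesz-Fischer argument: the increments are summable in $L^1$, so the series of
  their absolute values is finite almost everywhere and the sequence converges pointwise. Fatou's lemma turns
  the pointwise limit into a limit in norm. Sequences with geometrically decaying increments
  suffice, because minimizing sequences can be chosen to have this property.
\<close>

lemma L2_complete:
  assumes L2: "\<And>n. f n \<in> L2" and fast: "\<And>n. l2norm (f (Suc n) - f n) \<le> (1/2) ^ n"
  obtains g where "g \<in> L2" "(\<lambda>n. l2norm (f n - g)) \<longlonglongrightarrow> 0"
proof -
  define d where "d n = f (Suc n) - f n" for n
  have "integral\<^sup>N circle_measure (\<lambda>w. \<Sum>n. ennreal (cmod (rep (d n) w)))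
      = (\<Sum>n. integral\<^sup>N circle_measure (\<lambda>w. ennreal (cmod (rep (d n) w))))"
    by (rule nn_integral_suminf) measurable
  also have "\<dots> \<le> (\<Sum>n. ennreal ((1/2) ^ n))"
    by (intro suminf_le integral_cmod_le) (use L2 fast in \<open>auto simp: d_def intro: L2_diff\<close>)
  also have "\<dots> = ennreal (\<Sum>n. (1/2) ^ n)" by (rule suminf_ennreal2) auto
  also have "\<dots> < \<infinity>" by simp
  finally have "AE w in circle_measure. (\<Sum>n. ennreal (cmod (rep (d n) w))) \<noteq> \<infinity>"
    by (intro nn_integral_noteq_infinite) (auto simp: less_top)
  moreover have "AE w in circle_measure. \<forall>n. rep (d n) w = rep (f (Suc n)) w - rep (f n) w"
    unfolding AE_all_countable d_def using rep_diff by blast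
  ultimately have conv: "AE w in circle_measure. convergent (\<lambda>n. rep (f n) w)"
  proof eventually_elim
    case (elim w)
    have "summable (\<lambda>n. cmod (rep (d n) w))"
      by (rule summable_suminf_not_top) (use elim in auto)
    then have "summable (\<lambda>n. rep (d n) w)" by (rule summable_norm_cancel)
    then have "convergent (\<lambda>n. \<Sum>i<n. rep (d i) w)" by (simp add: summable_iff_convergent)
    moreover have "(\<Sum>i<n. rep (d i) w) = rep (f n) w - rep (f 0) w" for n
      using elim(2) sum_lessThan_telescope[of "\<lambda>i. rep (f i) w" n] by simp
    ultimately have "convergent (\<lambda>n. rep (f n) w - rep (f 0) w)" by simp
    then have "convergent (\<lambda>n. (rep (f n) w - rep (f 0) w) + rep (f 0) w)"
      by (intro convergent_add convergent_const)
    then show ?case by simp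
  qed
  define G where "G w = lim (\<lambda>n. rep (f n) w)" for w
  have G_meas: "G \<in> borel_measurable circle_measure"
    unfolding G_def by (rule borel_measurable_lim_metric) simp
  define g where "g = abs_circle_fun G"
  have lim: "AE w in circle_measure. (\<lambda>n. rep (f n) w) \<longlonglongrightarrow> rep g w"
    using conv rep_abs[OF G_meas]
    by eventually_elim (simp add: g_def G_def convergent_LIMSEQ_iff)
  \<comment> \<open>Fatou: the limit is at distance at most \<open>2 * (1/2) ^ n\<close> from \<open>f n\<close>.\<close>
  have fatou: "integral\<^sup>N circle_measure (\<lambda>w. ennreal ((cmod (rep (f n - g) w))\<^sup>2)) \<le> ennreal ((2 * (1/2) ^ n)\<^sup>2)" for n
  proof -
    have "AE w in circle_measure. \<forall>k. rep (f (n + k) - f n) w = rep (f (n + k)) w - rep (f n) w"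
      unfolding AE_all_countable using rep_diff by blast
    with lim rep_diff[of "f n" g]
    have "AE w in circle_measure. ennreal ((cmod (rep (f n - g) w))\<^sup>2)
        = liminf (\<lambda>k. ennreal ((cmod (rep (f (n + k) - f n) w))\<^sup>2))"
    proof eventually_elim
      case (elim w)
      have "(\<lambda>k. rep (f (n + k)) w) \<longlonglongrightarrow> rep g w"
        using LIMSEQ_ignore_initial_segment[OF elim(1), of n] by (simp add: add.commute)
      then have "(\<lambda>k. ennreal ((cmod (rep (f (n + k)) w - rep (f n) w))\<^sup>2))
          \<longlonglongrightarrow> ennreal ((cmod (rep g w - rep (f n) w))\<^sup>2)"
        by (intro tendsto_ennrealI tendsto_intros)
      then have "liminf (\<lambda>k. ennreal ((cmod (rep (f (n + k)) w - rep (f n) w))\<^sup>2))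
          = ennreal ((cmod (rep g w - rep (f n) w))\<^sup>2)"
        by (intro lim_imp_Liminf) auto
      then show ?case using elim by (simp add: norm_minus_commute)
    qed
    then have "integral\<^sup>N circle_measure (\<lambda>w. ennreal ((cmod (rep (f n - g) w))\<^sup>2))
        = integral\<^sup>N circle_measure (\<lambda>w. liminf (\<lambda>k. ennreal ((cmod (rep (f (n + k) - f n) w))\<^sup>2)))"
      by (rule nn_integral_cong_AE)
    also have "\<dots> \<le> liminf (\<lambda>k. integral\<^sup>N circle_measure (\<lambda>w. ennreal ((cmod (rep (f (n + k) - f n) w))\<^sup>2)))"
      by (rule nn_integral_liminf) measurable
    also have "\<dots> \<le> liminf (\<lambda>k. ennreal ((2 * (1/2) ^ n)\<^sup>2))"
    proof (rule Liminf_mono, rule always_eventually, rule allI)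
      fix k
      have "integral\<^sup>N circle_measure (\<lambda>w. ennreal ((cmod (rep (f (n + k) - f n) w))\<^sup>2))
          = ennreal ((l2norm (f (n + k) - f n))\<^sup>2)"
        unfolding l2norm_rep
        by (rule nn_integral_eq_integral) (use L2_diff[OF L2[of "n + k"] L2[of n]] in \<open>auto simp: L2_rep\<close>)
      also have "\<dots> \<le> ennreal ((2 * (1/2) ^ n)\<^sup>2)"
        by (intro ennreal_leI power_mono l2norm_tail[OF L2 fast]) auto
      finally show "integral\<^sup>N circle_measure (\<lambda>w. ennreal ((cmod (rep (f (n + k) - f n) w))\<^sup>2)) \<le> \<dots>" .
    qed
    also have "\<dots> = ennreal ((2 * (1/2) ^ n)\<^sup>2)" by (simp add: Liminf_const)
    finally show ?thesis .
  qed
  have diff_L2: "f n - g \<in> L2" for n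
    unfolding L2_rep
    by (rule integrableI_bounded) (use le_less_trans[OF fatou[of n]] in auto)
  have g: "g \<in> L2" using L2_diff[OF L2[of 0] diff_L2[of 0]] by simp
  have "l2norm (f n - g) \<le> 2 * (1/2) ^ n" for n
  proof -
    have "ennreal ((l2norm (f n - g))\<^sup>2) \<le> ennreal ((2 * (1/2) ^ n)\<^sup>2)"
      unfolding l2norm_rep using fatou[of n] diff_L2[of n]
      by (subst nn_integral_eq_integral[symmetric]) (auto simp: L2_rep)
    then have "(l2norm (f n - g))\<^sup>2 \<le> (2 * (1/2) ^ n)\<^sup>2" by (simp add: ennreal_le_iff)
    then show ?thesis by (rule power2_le_imp_le) simp
  qed
  moreover have "(\<lambda>n. 2 * (1/2) ^ n :: real) \<longlonglongrightarrow> 0" by (intro tendsto_mult_right_zero LIMSEQ_power_zero) simp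
  ultimately have "(\<lambda>n. l2norm (f n - g)) \<longlonglongrightarrow> 0"
    by (intro tendsto_sandwich[of "\<lambda>_. 0" "\<lambda>n. l2norm (f n - g)" sequentially "\<lambda>n. 2 * (1/2) ^ n" 0]) auto
  with g show ?thesis by (rule that)
qed

section \<open>Orthogonal complements, projections and adjoints\<close>

lemma ominusD: "f \<in> L2 \<ominus> S \<Longrightarrow> f \<in> L2" "f \<in> L2 \<ominus> S \<Longrightarrow> g \<in> S \<Longrightarrow> ip f g = 0"
  by (auto simp: ominus_def)

lemma ominus_add: "S \<subseteq> L2 \<Longrightarrow> f \<in> L2 \<ominus> S \<Longrightarrow> g \<in> L2 \<ominus> S \<Longrightarrow> f + g \<in> L2 \<ominus> S"
  by (auto simp: ominus_def L2_add ip_add_left subset_iff)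

lemma ominus_cscale: "f \<in> L2 \<ominus> S \<Longrightarrow> cscale c f \<in> L2 \<ominus> S"
  by (auto simp: ominus_def L2_cscale ip_cscale_left)

lemma ominus_diff: "S \<subseteq> L2 \<Longrightarrow> f \<in> L2 \<ominus> S \<Longrightarrow> g \<in> L2 \<ominus> S \<Longrightarrow> f - g \<in> L2 \<ominus> S"
  by (auto simp: ominus_def L2_diff ip_diff_left subset_iff)

lemma ominus_zero: "0 \<in> L2 \<ominus> S"
  by (auto simp: ominus_def L2_zero)

lemma ip_tendsto:
  assumes "\<And>n. f n \<in> L2" "g \<in> L2" "h \<in> L2" "(\<lambda>n. l2norm (f n - g)) \<longlonglongrightarrow> 0"
  shows "(\<lambda>n. ip (f n) h) \<longlonglongrightarrow> ip g h"
proof -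
  have "cmod (ip (f n) h - ip g h) \<le> l2norm (f n - g) * l2norm h" for n
    using cauchy_schwarz[of "f n - g" h] assms by (simp add: ip_diff_left L2_diff)
  moreover have "(\<lambda>n. l2norm (f n - g) * l2norm h) \<longlonglongrightarrow> 0"
    by (rule tendsto_mult_left_zero[OF assms(4)])
  ultimately have "(\<lambda>n. ip (f n) h - ip g h) \<longlonglongrightarrow> 0"
    by (intro Lim_null_comparison[of "\<lambda>n. ip (f n) h - ip g h"] always_eventually allI)
  then show ?thesis by (simp add: LIM_zero_iff)
qed

lemma ominus_closed:
  assumes "S \<subseteq> L2" "\<And>n. f n \<in> L2 \<ominus> S" "g \<in> L2" "(\<lambda>n. l2norm (f n - g)) \<longlonglongrightarrow> 0"
  shows "g \<in> L2 \<ominus> S"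
  unfolding ominus_def
proof (safe intro!: assms(3))
  fix h assume "h \<in> S"
  then have "(\<lambda>n. ip (f n) h) \<longlonglongrightarrow> ip g h"
    using assms by (intro ip_tendsto) (auto dest: ominusD)
  moreover have "ip (f n) h = 0" for n using assms(2) \<open>h \<in> S\<close> by (rule ominusD)
  ultimately show "ip g h = 0" by (simp add: LIMSEQ_const_iff)
qed

lemma parallelogram:
  assumes "f \<in> L2" "g \<in> L2"
  shows "(l2norm (f + g))\<^sup>2 + (l2norm (f - g))\<^sup>2 = 2 * (l2norm f)\<^sup>2 + 2 * (l2norm g)\<^sup>2"
  using l2norm_add_sq[OF assms] l2norm_add_sq[OF assms(1) L2_uminus[OF assms(2)]]
  by (simp add: ip_uminus_right)

text \<open>
  The representing vector minimizes \<open>J g = (l2norm g)\<^sup>2 - 2 * Re (F g)\<close>. By the parallelogram law,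
  vectors at which \<open>J\<close> is almost minimal are close to each other, so a minimizing sequence converges.
  Comparing \<open>J\<close> at \<open>g n\<close> with its values on the line through \<open>g n\<close> in direction \<open>f\<close>
  bounds the difference of \<open>Re (F f)\<close> and \<open>Re (ip (g n) f)\<close> by a multiple of the square root of the
  error at \<open>g n\<close>; in the limit the two real parts agree.
\<close>

lemma riesz_representation:
  assumes S: "S \<subseteq> L2"
    and add: "\<And>f g. f \<in> L2 \<ominus> S \<Longrightarrow> g \<in> L2 \<ominus> S \<Longrightarrow> F (f + g) = F f + F g"
    and scale: "\<And>c f. f \<in> L2 \<ominus> S \<Longrightarrow> F (cscale c f) = c * F f"
    and bound: "\<And>f. f \<in> L2 \<ominus> S \<Longrightarrow> cmod (F f) \<le> C * l2norm f"
  obtains h where "h \<in> L2 \<ominus> S" "\<And>f. f \<in> L2 \<ominus> S \<Longrightarrow> F f = ip f h"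
proof -
  define M where "M = L2 \<ominus> S"
  define J where "J g = (l2norm g)\<^sup>2 - 2 * Re (F g)" for g
  define I where "I = (INF g\<in>M. J g)"
  have ML2: "g \<in> L2" if "g \<in> M" for g using that by (auto simp: M_def dest: ominusD)
  have M0: "0 \<in> M" by (simp add: M_def ominus_zero)
  have "- C\<^sup>2 \<le> J g" if "g \<in> M" for g
  proof -
    have "Re (F g) \<le> C * l2norm g"
      using bound[of g] that complex_Re_le_cmod[of "F g"] by (simp add: M_def)
    moreover have "0 \<le> (l2norm g - C)\<^sup>2" by simp
    ultimately show ?thesis unfolding J_def power2_diff by (simp add: mult_ac)
  qed
  then have bdd: "bdd_below (J ` M)" by (auto intro!: bdd_belowI2)
  then have I_le: "I \<le> J g" if "g \<in> M" for g unfolding I_def using that by (rule cINF_lower)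
  \<comment> \<open>The error decays fast enough for consecutive terms to differ by at most \<open>(1/2) ^ n\<close>.\<close>
  have "\<exists>g\<in>M. J g < I + (1/4) ^ n / 4" for n :: nat
    using cINF_less_iff[OF _ bdd, of "I + (1/4) ^ n / 4"] M0 by (auto simp: I_def)
  then obtain g where gM: "g n \<in> M" and gJ: "J (g n) < I + (1/4) ^ n / 4" for n by metis
  have gJ': "J (g n) - I \<le> (1/4) ^ n / 4" for n using gJ[of n] by linarith
  have cauchy: "(l2norm (u - v))\<^sup>2 \<le> 2 * (J u - I) + 2 * (J v - I)" if "u \<in> M" "v \<in> M" for u v
  proof -
    have uv: "cscale (1/2) (u + v) \<in> M" using that S by (auto simp: M_def intro: ominus_cscale ominus_add)
    have "u + v \<in> M" using that S by (auto simp: M_def intro: ominus_add)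
    then have F2: "F (cscale (1/2) (u + v)) = (F u + F v) / 2"
      using that by (simp add: scale add M_def)
    have "4 * J (cscale (1/2) (u + v)) = (l2norm (u + v))\<^sup>2 - 4 * Re (F u) - 4 * Re (F v)"
      by (simp add: J_def F2 l2norm_cscale power_mult_distrib power_divide add_divide_distrib)
    then show ?thesis
      using parallelogram[OF ML2[OF that(1)] ML2[OF that(2)]] I_le[OF uv] by (simp add: J_def)
  qed
  have "l2norm (g (Suc n) - g n) \<le> (1/2) ^ n" for n
  proof -
    have "(l2norm (g (Suc n) - g n))\<^sup>2 \<le> 2 * (J (g (Suc n)) - I) + 2 * (J (g n) - I)"
      by (rule cauchy[OF gM gM])
    also have "\<dots> \<le> 2 * ((1/4) ^ Suc n / 4) + 2 * ((1/4) ^ n / 4)"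
      by (intro add_mono mult_left_mono gJ') auto
    also have "\<dots> \<le> (1/4) ^ n" by simp
    also have "\<dots> = ((1/2) ^ n)\<^sup>2" by (simp add: power_divide power_mult[symmetric] power2_eq_square
      power_mult_distrib[symmetric])
    finally show ?thesis by (rule power2_le_imp_le) simp
  qed
  then obtain h where h: "h \<in> L2" "(\<lambda>n. l2norm (g n - h)) \<longlonglongrightarrow> 0"
    using L2_complete[of g] ML2[OF gM] by blast
  have hM: "h \<in> M" unfolding M_def
    using ominus_closed[OF S _ h] gM by (simp add: M_def)
  have Re_eq: "Re (F f) = Re (ip f h)" if f: "f \<in> M" for f
  proof -
    have sq: "(Re (ip (g n) f) - Re (F f))\<^sup>2 \<le> (l2norm f)\<^sup>2 * ((1/4) ^ n / 4)" for n
    proof (rule quadratic_nonneg_imp)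
      fix t :: real
      have ft: "cscale t f \<in> M" using f by (simp add: M_def ominus_cscale)
      then have gt: "g n + cscale t f \<in> M" using gM[of n] S by (simp add: M_def ominus_add)
      have Fs: "F (g n + cscale t f) = F (g n) + t * F f"
        using gM[of n] ft f by (simp add: M_def add scale)
      have "J (g n + cscale t f)
          = J (g n) + (l2norm f)\<^sup>2 * t\<^sup>2 + 2 * (Re (ip (g n) f) - Re (F f)) * t"
        using l2norm_add_sq[OF ML2[OF gM] ML2[OF ft], of n]
        by (simp add: J_def Fs ip_cscale_right l2norm_cscale power_mult_distrib algebra_simps)
      then show "0 \<le> (l2norm f)\<^sup>2 * t\<^sup>2 + 2 * (Re (ip (g n) f) - Re (F f)) * t + (1/4) ^ n / 4"
        using I_le[OF gt] gJ[of n] by linarith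
    qed simp
    have "(\<lambda>n. (l2norm f)\<^sup>2 * ((1/4) ^ n / 4) :: real) \<longlonglongrightarrow> 0"
      by (intro tendsto_mult_right_zero tendsto_divide_zero LIMSEQ_power_zero) simp
    then have "(\<lambda>n. (Re (ip (g n) f) - Re (F f))\<^sup>2) \<longlonglongrightarrow> 0"
      by (rule Lim_null_comparison[OF always_eventually, rotated]) (use sq in auto)
    moreover have "(\<lambda>n. (Re (ip (g n) f) - Re (F f))\<^sup>2) \<longlonglongrightarrow> (Re (ip h f) - Re (F f))\<^sup>2"
      using ip_tendsto[OF ML2[OF gM] h(1) ML2[OF f] h(2)] by (intro tendsto_intros)
    ultimately have "(Re (ip h f) - Re (F f))\<^sup>2 = 0" by (rule LIMSEQ_unique[symmetric])
    then show ?thesis by (simp add: ip_cnj[of h f, symmetric])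
  qed
  have "F f = ip f h" if f: "f \<in> M" for f
  proof (rule complex_eqI)
    show "Re (F f) = Re (ip f h)" by (rule Re_eq[OF f])
    have "cscale \<i> f \<in> M" using f by (simp add: M_def ominus_cscale)
    from Re_eq[OF this] show "Im (F f) = Im (ip f h)"
      using f by (simp add: M_def scale ip_cscale_left)
  qed
  with hM show ?thesis using that unfolding M_def by blast
qed

lemma ominus_eqI:
  assumes "S \<subseteq> L2" "f \<in> L2 \<ominus> S" "g \<in> L2 \<ominus> S" "\<And>h. h \<in> L2 \<ominus> S \<Longrightarrow> ip h f = ip h g"
  shows "f = g"
proof -
  have d: "f - g \<in> L2 \<ominus> S" using assms by (intro ominus_diff)
  then have "ip (f - g) (f - g) = 0"
    using assms(4)[OF d] assms(2,3) by (simp add: ip_diff_right ominusD)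
  then show ?thesis using l2norm_eq_0[of "f - g"] ominusD(1)[OF d] by simp
qed

text \<open>
  The projection of \<open>f\<close> represents the functional \<open>\<lambda>h. ip h f\<close> on the complement.
\<close>

lemma proj_ominus:
  assumes S: "S \<subseteq> L2" and f: "f \<in> L2"
  shows proj_in: "proj (L2 \<ominus> S) f \<in> L2 \<ominus> S"
    and ip_proj: "\<And>h. h \<in> L2 \<ominus> S \<Longrightarrow> ip (proj (L2 \<ominus> S) f) h = ip f h"
proof -
  obtain g where g: "g \<in> L2 \<ominus> S" "\<And>h. h \<in> L2 \<ominus> S \<Longrightarrow> ip h f = ip h g"
  proof (rule riesz_representation[OF S, of "\<lambda>h. ip h f" "l2norm f"])
    show "cmod (ip h f) \<le> l2norm f * l2norm h" if "h \<in> L2 \<ominus> S" for h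
      using cauchy_schwarz[of h f] that f by (simp add: ominusD mult.commute)
  qed (use f in \<open>auto simp: ominusD ip_add_left ip_cscale_left\<close>)
  have *: "(\<forall>h\<in>L2 \<ominus> S. ip (f - u) h = 0) \<longleftrightarrow> (\<forall>h\<in>L2 \<ominus> S. ip h f = ip h u)" if "u \<in> L2 \<ominus> S" for u
  proof (intro ball_cong refl)
    fix h assume "h \<in> L2 \<ominus> S"
    then have "ip (f - u) h = cnj (ip h f - ip h u)"
      using f that by (simp add: ip_diff_left ominusD ip_cnj)
    then show "ip (f - u) h = 0 \<longleftrightarrow> ip h f = ip h u" by (simp del: complex_cnj_diff)
  qed
  have "proj (L2 \<ominus> S) f = g"
    unfolding proj_def
  proof (rule the_equality)
    show "g \<in> L2 \<ominus> S \<and> (\<forall>h\<in>L2 \<ominus> S. ip (f - g) h = 0)" using g * by blast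
    show "u = g" if "u \<in> L2 \<ominus> S \<and> (\<forall>h\<in>L2 \<ominus> S. ip (f - u) h = 0)" for u
    proof (rule ominus_eqI[OF S])
      show "u \<in> L2 \<ominus> S" "g \<in> L2 \<ominus> S" using that g by auto
      show "ip h u = ip h g" if "h \<in> L2 \<ominus> S" for h
        using * \<open>u \<in> L2 \<ominus> S \<and> _\<close> g(2)[OF that] that by metis
    qed
  qed
  with g show "proj (L2 \<ominus> S) f \<in> L2 \<ominus> S"
    and "\<And>h. h \<in> L2 \<ominus> S \<Longrightarrow> ip (proj (L2 \<ominus> S) f) h = ip f h"
    by (auto simp: ip_cnj[of _ f, symmetric] ip_cnj[of _ g, symmetric] intro: arg_cong[where f = cnj])
qed

lemma proj_eqI:
  assumes "S \<subseteq> L2" "f \<in> L2" "u \<in> L2 \<ominus> S" "\<And>h. h \<in> L2 \<ominus> S \<Longrightarrow> ip f h = ip u h"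
  shows "proj (L2 \<ominus> S) f = u"
proof (rule ominus_eqI[OF assms(1)])
  show "ip h (proj (L2 \<ominus> S) f) = ip h u" if "h \<in> L2 \<ominus> S" for h
    by (metis assms(4)[OF that] ip_proj[OF assms(1,2) that] ip_cnj)
qed (use assms proj_in in auto)

lemma adj_ominus:
  assumes S: "S \<subseteq> L2" and T: "T \<in> bounded_ops (L2 \<ominus> S) N" "N \<subseteq> L2" and g: "g \<in> L2"
  shows adj_in: "adj (L2 \<ominus> S) T g \<in> L2 \<ominus> S"
    and ip_adj: "\<And>f. f \<in> L2 \<ominus> S \<Longrightarrow> ip f (adj (L2 \<ominus> S) T g) = ip (T f) g"
proof -
  obtain C where C: "\<And>f. f \<in> L2 \<ominus> S \<Longrightarrow> l2norm (T f) \<le> C * l2norm f"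
    using T unfolding bounded_ops_def by blast
  have TL2: "\<And>f. f \<in> L2 \<ominus> S \<Longrightarrow> T f \<in> L2" using T unfolding bounded_ops_def by blast
  obtain h where h: "h \<in> L2 \<ominus> S" "\<And>f. f \<in> L2 \<ominus> S \<Longrightarrow> ip (T f) g = ip f h"
  proof (rule riesz_representation[OF S, of "\<lambda>f. ip (T f) g" "C * l2norm g"])
    show "cmod (ip (T f) g) \<le> C * l2norm g * l2norm f" if "f \<in> L2 \<ominus> S" for f
    proof -
      have "cmod (ip (T f) g) \<le> l2norm (T f) * l2norm g" using cauchy_schwarz TL2 g that by blast
      also have "\<dots> \<le> C * l2norm f * l2norm g" using C that by (intro mult_right_mono) auto
      finally show ?thesis by (simp add: mult_ac)
    qed
  qed (use T g TL2 in \<open>auto simp: ip_add_left ip_cscale_left bounded_ops_def\<close>)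
  have "adj (L2 \<ominus> S) T g = h"
    unfolding adj_def
    by (rule the_equality) (use h ominus_eqI[OF S] in metis)+
  with h show "adj (L2 \<ominus> S) T g \<in> L2 \<ominus> S"
    and "\<And>f. f \<in> L2 \<ominus> S \<Longrightarrow> ip f (adj (L2 \<ominus> S) T g) = ip (T f) g"
    by auto
qed

lemma l2norm_proj_le:
  assumes "S \<subseteq> L2" "f \<in> L2" shows "l2norm (proj (L2 \<ominus> S) f) \<le> l2norm f"
proof -
  let ?u = "proj (L2 \<ominus> S) f"
  have u: "?u \<in> L2 \<ominus> S" using assms by (rule proj_in)
  have "(l2norm ?u)\<^sup>2 = Re (ip f ?u)"
    unfolding ip_proj[OF assms u, symmetric] l2norm_ip by (rule Re_complex_of_real[symmetric])
  also have "\<dots> \<le> l2norm f * l2norm ?u"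
    using Re_ip_le[OF assms(2) ominusD(1)[OF u]] by simp
  finally have "l2norm ?u * l2norm ?u \<le> l2norm f * l2norm ?u" by (simp add: power2_eq_square)
  then show ?thesis using l2norm_nonneg[of ?u] l2norm_nonneg[of f]
    by (cases "l2norm ?u = 0") (auto simp: mult_le_cancel_right)
qed

lemma proj_comp_bounded:
  assumes "S \<subseteq> L2" "T \<in> bounded_ops M N" "N \<subseteq> L2"
  shows "proj (L2 \<ominus> S) \<circ> T \<in> bounded_ops M L2"
proof -
  let ?P = "proj (L2 \<ominus> S)"
  have TL2: "T f \<in> L2" if "f \<in> M" for f using assms that unfolding bounded_ops_def by blast
  obtain C where C: "\<And>f. f \<in> M \<Longrightarrow> l2norm (T f) \<le> C * l2norm f"
    using assms unfolding bounded_ops_def by blast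
  have "?P (u + v) = ?P u + ?P v" if "u \<in> L2" "v \<in> L2" for u v
    using assms(1) that
    by (intro proj_eqI ominus_add proj_in L2_add)
      (auto simp: ip_add_left ip_proj ominusD(1) proj_in[THEN ominusD(1)])
  moreover have "?P (cscale c u) = cscale c (?P u)" if "u \<in> L2" for c u
    using assms(1) that
    by (intro proj_eqI ominus_cscale proj_in L2_cscale) (auto simp: ip_cscale_left ip_proj)
  moreover have "l2norm (?P (T f)) \<le> C * l2norm f" if "f \<in> M" for f
    using l2norm_proj_le[OF assms(1) TL2[OF that]] C[OF that] by linarith
  ultimately show ?thesis
    using assms(2) TL2 ominusD(1)[OF proj_in[OF assms(1)]]
    unfolding bounded_ops_def mem_Collect_eq o_def
    by (intro conjI ballI allI exI[of _ C]) auto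
qed

text \<open>
  The orthogonal complements of sets are precisely the closed subspaces of \<open>L2\<close>. The predicate
  hides the set of which \<open>M\<close> is the complement, which differs from one space to the next.
\<close>

definition orthocomplement :: "circle_fun set \<Rightarrow> bool" where
  "orthocomplement M \<longleftrightarrow> (\<exists>S\<subseteq>L2. M = L2 \<ominus> S)"

lemma orthocomplement_L2: "orthocomplement M \<Longrightarrow> f \<in> M \<Longrightarrow> f \<in> L2"
  unfolding orthocomplement_def using ominusD by blast

lemma orthocomplement_diff: "orthocomplement M \<Longrightarrow> f \<in> M \<Longrightarrow> g \<in> M \<Longrightarrow> f - g \<in> M"
  unfolding orthocomplement_def using ominus_diff by blast

lemma orthocomplement_proj_in: "orthocomplement M \<Longrightarrow> f \<in> L2 \<Longrightarrow> proj M f \<in> M"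
  unfolding orthocomplement_def using proj_in by blast

lemma orthocomplement_ip_proj: "orthocomplement M \<Longrightarrow> f \<in> L2 \<Longrightarrow> h \<in> M \<Longrightarrow> ip (proj M f) h = ip f h"
  unfolding orthocomplement_def using ip_proj by blast

lemma orthocomplement_ip_proj': "orthocomplement M \<Longrightarrow> f \<in> L2 \<Longrightarrow> h \<in> M \<Longrightarrow> ip h (proj M f) = ip h f"
  by (metis orthocomplement_ip_proj ip_cnj)

lemma orthocomplement_proj_eq_iff:
  assumes "orthocomplement M" "f \<in> L2" "u \<in> M"
  shows "proj M f = u \<longleftrightarrow> (\<forall>h\<in>M. ip f h = ip u h)"
  using assms proj_eqI orthocomplement_ip_proj unfolding orthocomplement_def by metis

lemma orthocomplement_proj_eq_proj_iff:
  assumes "orthocomplement M" "f \<in> L2" "g \<in> L2"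
  shows "proj M f = proj M g \<longleftrightarrow> (\<forall>h\<in>M. ip f h = ip g h)"
  using assms by (simp add: orthocomplement_proj_eq_iff orthocomplement_proj_in orthocomplement_ip_proj)

lemma orthocomplement_proj_id: "orthocomplement M \<Longrightarrow> f \<in> M \<Longrightarrow> proj M f = f"
  by (simp add: orthocomplement_proj_eq_iff orthocomplement_L2)

lemma orthocomplement_adj:
  assumes "orthocomplement M" "T \<in> bounded_ops M N" "N \<subseteq> L2" "g \<in> L2"
  shows orthocomplement_adj_in: "adj M T g \<in> M" and orthocomplement_ip_adj: "f \<in> M \<Longrightarrow> ip f (adj M T g) = ip (T f) g"
  using assms adj_in ip_adj unfolding orthocomplement_def by blast+

lemma orthocomplement_proj_comp_bounded:
  "orthocomplement M \<Longrightarrow> T \<in> bounded_ops K N \<Longrightarrow> N \<subseteq> L2 \<Longrightarrow> proj M \<circ> T \<in> bounded_ops K L2"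
  unfolding orthocomplement_def using proj_comp_bounded by blast

lemma bounded_ops_mono: "T \<in> bounded_ops M N \<Longrightarrow> K \<subseteq> M \<Longrightarrow> N \<subseteq> N' \<Longrightarrow> T \<in> bounded_ops K N'"
  unfolding bounded_ops_def by blast

lemma ip_cnj_eq_iff: "ip f g = ip h g' \<longleftrightarrow> ip g f = ip g' h"
  by (metis ip_cnj)

text \<open>
  Density is used in its dual form, so no approximation is needed. For \<open>f\<close> in the total set \<open>F\<close>,
  the projection of \<open>T f - \<phi> * f\<close> to \<open>N\<close> is orthogonal to \<open>G\<close>, hence zero. With \<open>g\<close> fixed, the adjoint at \<open>g\<close> and
  the projection of \<open>cconj \<phi> * g\<close> then have equal inner products with \<open>F\<close>, hence coincide.
\<close>

lemma form_extends_from_total_sets: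
  assumes M: "orthocomplement M" and N: "orthocomplement N"
    and T: "T \<in> bounded_ops M L2" and \<phi>: "\<phi> \<in> Linf"
    and F: "F \<subseteq> M" "\<And>f. f \<in> M \<Longrightarrow> (\<And>g. g \<in> F \<Longrightarrow> ip f g = 0) \<Longrightarrow> f = 0"
    and G: "G \<subseteq> N" "\<And>f. f \<in> N \<Longrightarrow> (\<And>g. g \<in> G \<Longrightarrow> ip f g = 0) \<Longrightarrow> f = 0"
    and eq: "\<And>f g. f \<in> F \<Longrightarrow> g \<in> G \<Longrightarrow> ip (T f) g = ip (\<phi> * f) g"
    and f: "f \<in> M" and g: "g \<in> N"
  shows "ip (T f) g = ip (\<phi> * f) g"
proof -
  have TL2: "T f \<in> L2" if "f \<in> M" for f using T that by (auto simp: bounded_ops_def)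
  have gL2: "g \<in> L2" using N g by (rule orthocomplement_L2)
  have step: "ip (T k) g = ip (\<phi> * k) g" if k: "k \<in> F" for k
  proof -
    have L: "T k \<in> L2" "\<phi> * k \<in> L2" using k F(1) TL2 Linf_mult_L2[OF \<phi>] orthocomplement_L2[OF M] by auto
    then have "proj N (T k - \<phi> * k) = 0"
      using N G(1) eq k orthocomplement_L2[OF N]
      by (intro G(2)) (auto simp: orthocomplement_proj_in orthocomplement_ip_proj L2_diff ip_diff_left subset_iff)
    then have "ip (T k - \<phi> * k) g = 0" using orthocomplement_ip_proj[OF N L2_diff[OF L] g] by simp
    then show ?thesis using L gL2 by (simp add: ip_diff_left)
  qed
  let ?y = "adj M T g" and ?y' = "proj M (cconj \<phi> * g)"
  have L: "cconj \<phi> * g \<in> L2" using \<phi> gL2 by (intro Linf_mult_L2 Linf_cconj)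
  have y: "?y \<in> M" "?y' \<in> M" using M T gL2 L by (auto intro: orthocomplement_adj_in orthocomplement_proj_in)
  have "?y - ?y' = 0"
  proof (rule F(2))
    show "?y - ?y' \<in> M" using M y by (rule orthocomplement_diff)
    fix k assume k: "k \<in> F"
    then have "ip k ?y = ip k ?y'"
      using step[OF k] F(1) orthocomplement_ip_adj[OF M T order_refl gL2, of k] orthocomplement_ip_proj'[OF M L, of k] by (auto simp: ip_move)
    then have "ip k (?y - ?y') = 0"
      using k F(1) y orthocomplement_L2[OF M] by (simp add: ip_diff_right subset_iff)
    then show "ip (?y - ?y') k = 0" by (subst ip_eq_0_commute)
  qed
  then have "ip f ?y = ip f ?y'" by simp
  then show ?thesis
    using orthocomplement_ip_adj[OF M T order_refl gL2 f] orthocomplement_ip_proj'[OF M L f] by (simp add: ip_move)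
qed

section \<open>Trigonometric approximation\<close>

text \<open>
  Orthogonality of the powers of \<open>coord\<close>, computed with the primitive of \<open>\<lambda>t. cis (k * t)\<close>, which is periodic.
\<close>

lemma circle_integral_power:
  assumes "k > 0" shows "circle_integral (coord ^ k) = 0"
proof -
  have rep_pow: "AE w in circle_measure. rep (coord ^ n) w = w ^ n" for n
  proof (induction n)
    case 0
    then show ?case using rep_one by simp
  next
    case (Suc n)
    then show ?case using rep_mult[of coord "coord ^ n"] rep_coord by eventually_elim simp
  qed
  have "circle_integral (coord ^ k) = integral\<^sup>L circle_measure (\<lambda>w. w ^ k)"
    unfolding circle_integral_rep by (rule integral_cong_AE) (use rep_pow in auto)
  also have "\<dots> = integral\<^sup>L (uniform_measure lborel {0..2 * pi}) (\<lambda>t. cis t ^ k)"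
    unfolding circle_measure_def by (rule integral_distr) (auto simp: measurable_cis_borel)
  also have "\<dots> = integral\<^sup>L lborel (\<lambda>t. (indicator {0..2 * pi} t / (2 * pi)) *\<^sub>R cis t ^ k)"
  proof -
    have "uniform_measure lborel {0..2 * pi} = density lborel (\<lambda>t. ennreal (indicator {0..2 * pi} t / (2 * pi)))"
      unfolding uniform_measure_def by (rule density_cong) (auto simp: indicator_def divide_ennreal[symmetric])
    then show ?thesis by (simp add: integral_density)
  qed
  also have "\<dots> = (1 / (2 * pi)) *\<^sub>R integral\<^sup>L lborel (\<lambda>t. indicator {0..2 * pi} t *\<^sub>R cis t ^ k)"
    unfolding integral_scaleR_right[symmetric] by (rule Bochner_Integration.integral_cong) auto
  also have "integral\<^sup>L lborel (\<lambda>t. indicator {0..2 * pi} t *\<^sub>R cis t ^ k)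
      = cis (real k * (2 * pi)) / (\<i> * k) - cis (real k * 0) / (\<i> * k)"
  proof (rule integral_FTC_Icc)
    fix x :: real
    have "((\<lambda>z. exp (\<i> * k * z) / (\<i> * k)) has_field_derivative exp (\<i> * k * of_real x)) (at (of_real x))"
      using assms by (auto intro!: derivative_eq_intros)
    then have "((\<lambda>t. exp (\<i> * k * of_real t) / (\<i> * k)) has_vector_derivative exp (\<i> * k * of_real x))
        (at x within {0..2 * pi})"
      by (rule has_vector_derivative_real_field)
    then show "((\<lambda>t. cis (real k * t) / (\<i> * k)) has_vector_derivative cis x ^ k) (at x within {0..2 * pi})"
      by (simp only: Complex.DeMoivre) (simp add: cis_conv_exp mult.assoc)
  qed (auto intro!: continuous_intros)
  also have "cis (real k * (2 * pi)) = 1"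
    using cis_multiple_2pi[of "real k"] by (simp add: mult_ac)
  finally show ?thesis by simp
qed

text \<open>
  Squares of polynomials approximate indicator functions of compact sets boundedly and
  pointwise on the circle, so the integral of \<open>h\<close> over every compact set is nonnegative. Therefore
  compact subsets of the set where \<open>h\<close> is negative are null, and by inner regularity so is that set.
\<close>

lemma nonneg_of_integral_squares:
  fixes h :: "complex \<Rightarrow> real"
  assumes int: "integrable circle_measure h"
    and pos: "\<And>p. real_polynomial_function p \<Longrightarrow> 0 \<le> integral\<^sup>L circle_measure (\<lambda>w. h w * (p w)\<^sup>2)"
  shows "AE w in circle_measure. 0 \<le> h w"
proof -
  have [measurable]: "h \<in> borel_measurable circle_measure" using int by auto
  have compact_nonneg: "0 \<le> integral\<^sup>L circle_measure (\<lambda>w. h w * indicator F w)" if F: "compact F" for F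
  proof (cases "F = {}")
    case False
    \<comment> \<open>Continuous functions decreasing to the indicator function of \<open>F\<close>.\<close>
    define u where "u n w = max 0 (1 - real n * infdist w F)" for n w
    have "\<exists>p. real_polynomial_function p \<and> (\<forall>w\<in>sphere 0 1. \<bar>u n w - p w\<bar> < 1 / real (Suc n))" for n
    proof -
      have "continuous_on (sphere 0 1) (u n)"
        unfolding u_def by (intro continuous_intros)
      then show ?thesis
        using Stone_Weierstrass_real_polynomial_function[of "sphere (0::complex) 1" "u n" "1 / real (Suc n)"]
        by (metis compact_sphere of_nat_0_less_iff zero_less_Suc zero_less_divide_1_iff)
    qed
    then obtain p where p: "\<And>n. real_polynomial_function (p n)"
      "\<And>n w. w \<in> sphere 0 1 \<Longrightarrow> \<bar>u n w - p n w\<bar> < 1 / real (Suc n)" by metis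
    have [measurable]: "p n \<in> borel_measurable circle_measure" for n
      using continuous_real_polymonial_function[OF p(1)]
      by (auto intro!: borel_measurable_continuous_onI continuous_at_imp_continuous_on
        simp: measurable_cong_sets[OF sets_circle_measure refl])
    have [measurable]: "F \<in> sets borel" using F by (simp add: borel_compact)
    have u01: "0 \<le> u n w" "u n w \<le> 1" for n w by (auto simp: u_def infdist_nonneg)
    have u_lim: "(\<lambda>n. u n w) \<longlonglongrightarrow> indicator F w" for w
    proof (cases "w \<in> F")
      case True
      then show ?thesis by (simp add: u_def)
    next
      case False
      then have d: "infdist w F > 0"
        using \<open>F \<noteq> {}\<close> F in_closed_iff_infdist_zero[OF compact_imp_closed[OF F]] infdist_nonneg[of w F] by fastforce
      obtain N where N: "1 / infdist w F < real N" using reals_Archimedean2 by blast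
      have "u n w = 0" if "n \<ge> N" for n
      proof -
        have "1 / infdist w F \<le> real n" using N that by linarith
        then have "1 \<le> real n * infdist w F" using d by (simp add: field_simps)
        then show ?thesis by (simp add: u_def)
      qed
      then have "eventually (\<lambda>n. u n w = 0) sequentially" by (auto simp: eventually_sequentially)
      then show ?thesis using False by (simp add: tendsto_eventually)
    qed
    have p_lim: "(\<lambda>n. p n w) \<longlonglongrightarrow> indicator F w" if "cmod w = 1" for w
    proof -
      have "(\<lambda>n. p n w - u n w) \<longlonglongrightarrow> 0"
      proof (rule Lim_null_comparison[OF always_eventually])
        show "\<forall>n. norm (p n w - u n w) \<le> 1 / real (Suc n)"
          using p(2)[of w] that by (auto simp: abs_minus_commute less_imp_le)
        show "(\<lambda>n. 1 / real (Suc n)) \<longlonglongrightarrow> 0" by (rule LIMSEQ_Suc[OF lim_1_over_n])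
      qed
      from tendsto_add[OF this u_lim[of w]] show ?thesis by simp
    qed
    have p_bound: "\<bar>p n w\<bar> \<le> 2" if "cmod w = 1" for n w
    proof -
      have "\<bar>u n w - p n w\<bar> < 1 / real (Suc n)" using p(2) that by simp
      moreover have "1 / real (Suc n) \<le> 1" by simp
      ultimately show ?thesis using u01[of n w] by linarith
    qed
    have "(\<lambda>n. integral\<^sup>L circle_measure (\<lambda>w. h w * (p n w)\<^sup>2))
        \<longlonglongrightarrow> integral\<^sup>L circle_measure (\<lambda>w. h w * indicator F w)"
    proof (rule integral_dominated_convergence[where w = "\<lambda>w. 4 * \<bar>h w\<bar>"])
      show "AE w in circle_measure. (\<lambda>n. h w * (p n w)\<^sup>2) \<longlonglongrightarrow> h w * indicator F w"
        using AE_on_circle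
      proof eventually_elim
        case (elim w)
        have "(\<lambda>n. h w * (p n w)\<^sup>2) \<longlonglongrightarrow> h w * (indicator F w)\<^sup>2"
          by (intro tendsto_intros p_lim elim)
        then show ?case by (cases "w \<in> F") simp_all
      qed
      show "AE w in circle_measure. norm (h w * (p n w)\<^sup>2) \<le> 4 * \<bar>h w\<bar>" for n
        using AE_on_circle
      proof eventually_elim
        case (elim w)
        have "(p n w)\<^sup>2 \<le> 2\<^sup>2" using p_bound[OF elim, of n] by (metis abs_ge_zero power2_abs power_mono)
        then show ?case by (simp add: abs_mult mult.commute[of 4] mult_left_mono)
      qed
    qed (use int in auto)
    then show ?thesis by (rule LIMSEQ_le_const) (use pos p(1) in auto)
  qed simp
  define B where "B = {w. h w < 0}"
  have B: "B \<in> sets borel"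
    using borel_measurable_less[of h circle_measure "\<lambda>_. 0"]
    by (simp add: B_def space_circle_measure sets_circle_measure)
  have null: "emeasure circle_measure F = 0" if "F \<subseteq> B" "compact F" for F
  proof -
    have [measurable]: "F \<in> sets borel" using that by (simp add: borel_compact)
    have int': "integrable circle_measure (\<lambda>w. - (h w * indicator F w))"
      using integrable_mult_indicator[OF _ int, of F] by (simp add: sets_circle_measure mult.commute)
    have nn: "AE w in circle_measure. 0 \<le> - (h w * indicator F w)"
      by (intro AE_I2) (use that(1) in \<open>auto simp: B_def indicator_def intro: less_imp_le\<close>)
    have "integral\<^sup>L circle_measure (\<lambda>w. - (h w * indicator F w)) = 0"
      using compact_nonneg[OF that(2)] integral_nonneg_AE[OF nn] by simp
    then have "AE w in circle_measure. - (h w * indicator F w) = 0"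
      using integral_nonneg_eq_0_iff_AE[OF int' nn] by blast
    then have "AE w in circle_measure. w \<notin> F"
      by eventually_elim (use that(1) in \<open>auto simp: B_def indicator_def\<close>)
    then show ?thesis
      by (subst (asm) AE_iff_measurable[of F]) (auto simp: sets_circle_measure space_circle_measure)
  qed
  have "emeasure circle_measure B = (SUP K \<in> {K. K \<subseteq> B \<and> compact K}. emeasure circle_measure K)"
    by (rule inner_regular) (auto simp: sets_circle_measure B emeasure_circle_measure_UNIV space_circle_measure)
  also have "\<dots> = 0" using null by (auto intro!: antisym SUP_least)
  finally have "B \<in> null_sets circle_measure" by (simp add: null_sets_def B sets_circle_measure)
  then have "AE w in circle_measure. w \<notin> B" by (rule AE_not_in)
  then show ?thesis by eventually_elim (simp add: B_def)
qed

text \<open>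
  Polynomials in \<open>coord\<close>. Every trigonometric polynomial becomes one of these after multiplication
  by a power of \<open>coord\<close>, a step that preserves the forms and norms considered below.
\<close>

inductive_set analytic_poly :: "circle_fun set" where
  monom: "cscale c (coord ^ n) \<in> analytic_poly"
| add: "p \<in> analytic_poly \<Longrightarrow> q \<in> analytic_poly \<Longrightarrow> p + q \<in> analytic_poly"

lemma analytic_poly_mult:
  assumes "p \<in> analytic_poly" "q \<in> analytic_poly" shows "p * q \<in> analytic_poly"
  using assms(1)
proof induction
  case (monom c n)
  show ?case using assms(2)
    by induction (auto simp: cscale_mult cscale_cscale power_add[symmetric] distrib_left intro: analytic_poly.intros)
qed (auto simp: distrib_right intro: analytic_poly.add)

lemma coord_power_analytic_poly: "coord ^ n \<in> analytic_poly"
  using analytic_poly.monom[of 1 n] by simp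

lemma analytic_poly_Linf: "p \<in> analytic_poly \<Longrightarrow> p \<in> Linf"
proof (induction rule: analytic_poly.induct)
  case (monom c n)
  have "cscale c 1 \<in> Linf" unfolding Linf_rep
    using rep_cscale[of c 1] rep_one by (auto intro!: exI[of _ "cmod c"] elim: eventually_elim2)
  then have "cscale c 1 * coord ^ n \<in> Linf"
    by (rule Linf_mult) (intro unimodular_Linf unimodular_power unimodular_coord)
  then show ?case by (simp add: cscale_mult)
next
  case (add p q)
  then obtain C E where "AE w in circle_measure. cmod (rep p w) \<le> C"
    "AE w in circle_measure. cmod (rep q w) \<le> E"
    unfolding Linf_rep by blast
  with rep_add[of p q] have "AE w in circle_measure. cmod (rep (p + q) w) \<le> C + E"
    by eventually_elim (auto intro: norm_triangle_le)
  then show ?case unfolding Linf_rep by blast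
qed

lemma analytic_poly_L2: "p \<in> analytic_poly \<Longrightarrow> p \<in> L2"
  by (intro Linf_L2 analytic_poly_Linf)

text \<open>
  A real polynomial in the real and imaginary parts of \<open>w\<close> is a polynomial in \<open>w\<close> and \<open>cnj w\<close>, and
  on the circle multiplication by a high power of \<open>w\<close> absorbs all factors \<open>cnj w\<close>.
\<close>

lemma rep_real_poly:
  assumes "real_polynomial_function p"
  obtains q n where "coord ^ n * q \<in> analytic_poly" "AE w in circle_measure. rep q w = complex_of_real (p w)"
proof -
  from assms have "\<exists>n q. coord ^ n * q \<in> analytic_poly \<and> (AE w in circle_measure. rep q w = complex_of_real (p w))"
  proof induction
    case (linear f)
    \<comment> \<open>The coefficient for which \<open>f w = a * w + cnj (a * w)\<close>.\<close>
    define a where "a = Complex (f 1 / 2) (- f \<i> / 2)"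
    define q where "q = cscale a coord + cscale (cnj a) (cconj coord)"
    have "coord * q = cscale a (coord ^ 2) + cscale (cnj a) (coord ^ 0)"
      by (simp add: q_def distrib_left cscale_mult unimodular_cancel unimodular_coord power2_eq_square)
    then have "coord ^ 1 * q \<in> analytic_poly" unfolding power_one_right by (simp only:) (intro analytic_poly.intros)
    moreover have "AE w in circle_measure. rep q w = complex_of_real (f w)"
      using rep_add[of "cscale a coord" "cscale (cnj a) (cconj coord)"] rep_cscale[of a coord]
        rep_cscale[of "cnj a" "cconj coord"] rep_cconj[of coord] rep_coord
    proof eventually_elim
      case (elim w)
      have "Re w *\<^sub>R 1 + Im w *\<^sub>R \<i> = w" by (simp add: complex_eq_iff)
      moreover have "f (Re w *\<^sub>R 1 + Im w *\<^sub>R \<i>) = Re w * f 1 + Im w * f \<i>"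
        using bounded_linear.linear[OF linear] by (simp add: linear_add linear_scale)
      ultimately have "f w = Re w * f 1 + Im w * f \<i>" by metis
      then show ?case using elim by (auto simp: q_def a_def complex_eq_iff field_simps)
    qed
    ultimately show ?case by blast
  next
    case (const c)
    have "coord ^ 0 * cscale c (coord ^ 0) \<in> analytic_poly" using analytic_poly.monom[of c 0] by simp
    moreover have "AE w in circle_measure. rep (cscale c (coord ^ 0)) w = complex_of_real c"
      using rep_cscale[of c 1] rep_one by eventually_elim simp
    ultimately show ?case by blast
  next
    case (add f g)
    then obtain m n q r where *: "coord ^ m * q \<in> analytic_poly" "AE w in circle_measure. rep q w = complex_of_real (f w)"
      "coord ^ n * r \<in> analytic_poly" "AE w in circle_measure. rep r w = complex_of_real (g w)" by blast
    have "coord ^ n * (coord ^ m * q) + coord ^ m * (coord ^ n * r) \<in> analytic_poly"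
      by (intro analytic_poly.add analytic_poly_mult[OF coord_power_analytic_poly *(1)] analytic_poly_mult[OF coord_power_analytic_poly *(3)])
    then have "coord ^ (m + n) * (q + r) \<in> analytic_poly" by (simp add: power_add algebra_simps)
    moreover have "AE w in circle_measure. rep (q + r) w = complex_of_real (f w + g w)"
      using *(2,4) rep_add[of q r] by eventually_elim simp
    ultimately show ?case by blast
  next
    case (mult f g)
    then obtain m n q r where *: "coord ^ m * q \<in> analytic_poly" "AE w in circle_measure. rep q w = complex_of_real (f w)"
      "coord ^ n * r \<in> analytic_poly" "AE w in circle_measure. rep r w = complex_of_real (g w)" by blast
    have "(coord ^ m * q) * (coord ^ n * r) \<in> analytic_poly"
      using * by (intro analytic_poly_mult[OF *(1) *(3)])
    then have "coord ^ (m + n) * (q * r) \<in> analytic_poly" by (simp add: power_add algebra_simps)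
    moreover have "AE w in circle_measure. rep (q * r) w = complex_of_real (f w * g w)"
      using *(2,4) rep_mult[of q r] by eventually_elim simp
    ultimately show ?case by blast
  qed
  then show ?thesis using that by blast
qed

text \<open>
  Because multiplication by a power of \<open>coord\<close> is unitary and commutes with \<open>\<psi>\<close>, the bound passes from analytic to
  trigonometric polynomials. Testing with real ones shows that \<open>C - Re (s * \<psi>)\<close> integrates to a nonnegative
  number against squares of real polynomials for every \<open>s\<close> of modulus one, hence is nonnegative. The choices
  \<open>s = 1, -1, \<i>, -\<i>\<close> bound real and imaginary part, whence the factor \<open>2\<close>.
\<close>

lemma bounded_of_toeplitz_form:
  assumes \<psi>: "\<psi> \<in> L2" and bound: "\<And>p. p \<in> analytic_poly \<Longrightarrow> cmod (ip (\<psi> * p) p) \<le> C * (l2norm p)\<^sup>2"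
  shows "AE w in circle_measure. cmod (rep \<psi> w) \<le> 2 * C"
proof -
  have half_plane: "AE w in circle_measure. Re (s * rep \<psi> w) \<le> C" if s: "cmod s = 1" for s
  proof -
    have "AE w in circle_measure. 0 \<le> C - Re (s * rep \<psi> w)"
    proof (rule nonneg_of_integral_squares)
      have "1 \<in> L2" by (intro Linf_L2 unimodular_Linf unimodular_one)
      then have "integrable circle_measure (\<lambda>w. rep \<psi> w * cnj (rep 1 w))" using \<psi> by (intro integrable_ip)
      then have "integrable circle_measure (rep \<psi>)"
        by (rule integrable_cong_AE_imp) (use rep_one in \<open>auto elim: eventually_mono\<close>)
      then show "integrable circle_measure (\<lambda>w. C - Re (s * rep \<psi> w))"
        by (intro Bochner_Integration.integrable_diff integrable_circle_const integrable_Re integrable_mult_right)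
      fix p :: "complex \<Rightarrow> real" assume p: "real_polynomial_function p"
      obtain q n where q: "coord ^ n * q \<in> analytic_poly" "AE w in circle_measure. rep q w = complex_of_real (p w)"
        using rep_real_poly[OF p] .
      have u: "unimodular (coord ^ n)" by (intro unimodular_power unimodular_coord)
      have qq: "q = cconj (coord ^ n) * (coord ^ n * q)"
        by (simp add: mult.assoc[symmetric] unimodular_cancel[OF u] del: cconj_power)
      have qL: "q \<in> Linf"
        by (subst qq, intro Linf_mult Linf_cconj unimodular_Linf[OF u] analytic_poly_Linf[OF q(1)])
      have qL2: "q \<in> L2" "\<psi> * q \<in> L2" using qL \<psi> Linf_mult_L2[of q \<psi>] by (auto simp: mult.commute Linf_L2)
      have [measurable]: "p \<in> borel_measurable circle_measure"
        using continuous_real_polymonial_function[OF p]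
        by (auto intro!: borel_measurable_continuous_onI continuous_at_imp_continuous_on
          simp: measurable_cong_sets[OF sets_circle_measure refl])
      have int1: "integrable circle_measure (\<lambda>w. rep \<psi> w * (p w)\<^sup>2)"
        and eq1: "ip (\<psi> * q) q = integral\<^sup>L circle_measure (\<lambda>w. rep \<psi> w * (p w)\<^sup>2)"
      proof -
        have ae: "AE w in circle_measure. rep (\<psi> * q) w * cnj (rep q w) = rep \<psi> w * (p w)\<^sup>2"
          using rep_mult[of \<psi> q] q(2) by eventually_elim (simp add: power2_eq_square)
        have m: "(\<lambda>w. rep (\<psi> * q) w * cnj (rep q w)) \<in> borel_measurable circle_measure"
          using integrable_ip[OF qL2(2,1)] by auto
        show "integrable circle_measure (\<lambda>w. rep \<psi> w * (p w)\<^sup>2)"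
          by (rule integrable_cong_AE_imp[OF integrable_ip[OF qL2(2,1)]]) (use ae in auto)
        show "ip (\<psi> * q) q = integral\<^sup>L circle_measure (\<lambda>w. rep \<psi> w * (p w)\<^sup>2)"
          unfolding rep_ip by (rule integral_cong_AE) (use ae m in auto)
      qed
      have int2: "integrable circle_measure (\<lambda>w. (p w)\<^sup>2)"
        and eq2: "(l2norm q)\<^sup>2 = integral\<^sup>L circle_measure (\<lambda>w. (p w)\<^sup>2)"
      proof -
        have ae: "AE w in circle_measure. (cmod (rep q w))\<^sup>2 = (p w)\<^sup>2"
          using q(2) by eventually_elim simp
        show "integrable circle_measure (\<lambda>w. (p w)\<^sup>2)"
          by (rule integrable_cong_AE_imp[OF qL2(1)[unfolded L2_rep]]) (use ae in auto)
        show "(l2norm q)\<^sup>2 = integral\<^sup>L circle_measure (\<lambda>w. (p w)\<^sup>2)"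
          unfolding l2norm_rep by (rule integral_cong_AE) (use ae in auto)
      qed
      have "ip (\<psi> * q) q = ip (\<psi> * (coord ^ n * q)) (coord ^ n * q)"
        by (simp add: mult.left_commute[of \<psi>] ip_unimodular[OF u])
      then have "cmod (ip (\<psi> * q) q) \<le> C * (l2norm q)\<^sup>2"
        using bound[OF q(1)] by (simp add: l2norm_unimodular[OF u])
      moreover have "Re (s * ip (\<psi> * q) q) \<le> cmod (ip (\<psi> * q) q)"
        using complex_Re_le_cmod[of "s * ip (\<psi> * q) q"] s by (simp add: norm_mult)
      ultimately have "0 \<le> C * (l2norm q)\<^sup>2 - Re (s * ip (\<psi> * q) q)" by linarith
      also have "s * ip (\<psi> * q) q = integral\<^sup>L circle_measure (\<lambda>w. s * (rep \<psi> w * (p w)\<^sup>2))"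
        by (simp add: eq1)
      also have "Re \<dots> = integral\<^sup>L circle_measure (\<lambda>w. Re (s * (rep \<psi> w * (p w)\<^sup>2)))"
        by (rule integral_Re[symmetric]) (intro integrable_mult_right int1)
      also have "C * (l2norm q)\<^sup>2 = integral\<^sup>L circle_measure (\<lambda>w. C * (p w)\<^sup>2)"
        by (simp add: eq2)
      also have "integral\<^sup>L circle_measure (\<lambda>w. C * (p w)\<^sup>2) - integral\<^sup>L circle_measure (\<lambda>w. Re (s * (rep \<psi> w * (p w)\<^sup>2)))
          = integral\<^sup>L circle_measure (\<lambda>w. C * (p w)\<^sup>2 - Re (s * (rep \<psi> w * (p w)\<^sup>2)))"
        by (rule Bochner_Integration.integral_diff[symmetric]) (intro integrable_Re integrable_mult_right int1 int2)+
      also have "(\<lambda>w. C * (p w)\<^sup>2 - Re (s * (rep \<psi> w * (p w)\<^sup>2))) = (\<lambda>w. (C - Re (s * rep \<psi> w)) * (p w)\<^sup>2)"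
        by (auto simp: algebra_simps simp flip: of_real_power)
      finally show "0 \<le> integral\<^sup>L circle_measure (\<lambda>w. (C - Re (s * rep \<psi> w)) * (p w)\<^sup>2)" .
    qed
    then show ?thesis by eventually_elim simp
  qed
  have "AE w in circle_measure. Re (rep \<psi> w) \<le> C" "AE w in circle_measure. - Re (rep \<psi> w) \<le> C"
    "AE w in circle_measure. - Im (rep \<psi> w) \<le> C" "AE w in circle_measure. Im (rep \<psi> w) \<le> C"
    using half_plane[of 1] half_plane[of "-1"] half_plane[of \<i>] half_plane[of "-\<i>"] by simp_all
  then show ?thesis
  proof eventually_elim
    case (elim w)
    then show ?case using cmod_le[of "rep \<psi> w"] by linarith
  qed
qed

text \<open>
  All Toeplitz form values of \<open>f\<close> on polynomials are combinations of its Fourier coefficients, so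
  the form is bounded with constant \<open>0\<close>.
\<close>

lemma fourier_uniqueness:
  assumes f: "f \<in> L2" and pos: "\<And>n. ip f (coord ^ n) = 0" and neg: "\<And>n. n > 0 \<Longrightarrow> ip f (cconj coord ^ n) = 0"
  shows "f = 0"
proof -
  have uc: "unimodular (coord ^ n)" for n by (intro unimodular_power unimodular_coord)
  have mono: "ip f (cconj coord ^ m * coord ^ n) = 0" for m n
  proof (cases "m \<le> n")
    case True
    then have "cconj coord ^ m * coord ^ n = (cconj (coord ^ m) * coord ^ m) * coord ^ (n - m)"
      by (simp add: mult.assoc power_add[symmetric])
    then show ?thesis using pos by (simp add: unimodular_cancel[OF uc] del: cconj_power)
  next
    case False
    then have "cconj coord ^ m = cconj coord ^ (m - n) * cconj (coord ^ n)"
      by (simp add: power_add[symmetric])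
    then have "cconj coord ^ m * coord ^ n = cconj coord ^ (m - n) * (cconj (coord ^ n) * coord ^ n)"
      by (simp add: mult.assoc)
    then show ?thesis using neg[of "m - n"] False by (simp add: unimodular_cancel[OF uc] del: cconj_power)
  qed
  have mono': "ip f (cconj coord ^ m * q) = 0" if "q \<in> analytic_poly" for m q
    using that
  proof induction
    case (add p q)
    then show ?case using f
      by (simp add: distrib_left ip_add_right Linf_L2 Linf_mult analytic_poly_Linf
        unimodular_Linf unimodular_power unimodular_cconj unimodular_coord)
  qed (simp add: cscale_mult ip_cscale_right mono)
  have "ip f (cconj p * q) = 0" if "p \<in> analytic_poly" "q \<in> analytic_poly" for p q
    using that(1)
  proof induction
    case (add p p')
    then show ?case using f that(2)
      by (simp add: distrib_right ip_add_right Linf_L2 Linf_mult Linf_cconj analytic_poly_Linf)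
  qed (simp add: cscale_mult ip_cscale_right mono' that)
  then have "ip (f * p) p = 0" if "p \<in> analytic_poly" for p
    using that by (simp add: mult.commute[of f] ip_move)
  then have "AE w in circle_measure. cmod (rep f w) \<le> 2 * 0"
    by (intro bounded_of_toeplitz_form[OF f]) simp
  then have "AE w in circle_measure. rep f w = rep 0 w"
    using rep_zero by eventually_elim simp
  then show ?thesis by (rule rep_eqI)
qed

section \<open>Hardy spaces and their shifts\<close>

lemma unimodular_coord_power: "unimodular (coord ^ n)" "unimodular (cconj coord ^ n)"
  by (intro unimodular_power unimodular_cconj unimodular_coord)+

lemma coord_power_L2: "coord ^ n \<in> L2" "cconj coord ^ n \<in> L2"
  by (intro Linf_L2 unimodular_Linf unimodular_coord_power)+

lemma unimodular_mult_L2: "unimodular u \<Longrightarrow> f \<in> L2 \<Longrightarrow> u * f \<in> L2"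
  by (rule Linf_mult_L2[OF unimodular_Linf])

lemma ip_coord_powers: "n > 0 \<Longrightarrow> ip (coord ^ j) (cconj coord ^ n) = 0"
  by (simp add: ip_def power_add[symmetric] circle_integral_power)

lemma H2_ominus: "H2 = L2 \<ominus> {cconj coord ^ n | n. n > 0}"
  by (auto simp: H2_def ominus_def)

lemma coord_powers_subset_L2: "{cconj coord ^ n | n. P n} \<subseteq> L2"
  using coord_power_L2 by auto

lemma H2_L2: "H2 \<subseteq> L2" by (auto simp: H2_def)

lemma H2m_L2: "H2m \<subseteq> L2" by (auto simp: H2m_def ominus_def)

lemma coord_power_H2: "coord ^ n \<in> H2"
  by (simp add: H2_def coord_power_L2 ip_coord_powers)

lemma cconj_coord_power_H2m: "n > 0 \<Longrightarrow> cconj coord ^ n \<in> H2m"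
  by (auto simp: H2m_def ominus_def coord_power_L2 H2_def ip_eq_0_commute[of "cconj coord ^ n"])

lemma H2_eq_0:
  assumes "f \<in> H2" "\<And>n. ip f (coord ^ n) = 0" shows "f = 0"
  by (rule fourier_uniqueness) (use assms in \<open>auto simp: H2_def\<close>)

text \<open>
  Orthogonality to the powers of \<open>coord\<close> suffices: the projection to \<open>H2\<close> then has no nonzero Fourier
  coefficient.
\<close>

lemma H2mI:
  assumes f: "f \<in> L2" and z: "\<And>n. ip f (coord ^ n) = 0" shows "f \<in> H2m"
proof -
  have p: "proj H2 f \<in> H2" "ip (proj H2 f) h = ip f h" if "h \<in> H2" for h
    using proj_ominus[OF coord_powers_subset_L2 f] that unfolding H2_ominus by auto
  have "proj H2 f = 0"
    using p coord_power_H2 z by (intro H2_eq_0) auto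
  then have "ip f h = 0" if "h \<in> H2" for h using p(2)[OF that] by simp
  then show ?thesis using f by (simp add: H2m_def ominus_def)
qed

lemma H2_coord: "h \<in> H2 \<Longrightarrow> coord * h \<in> H2"
proof -
  assume h: "h \<in> H2"
  have "ip (coord * h) (cconj coord ^ n) = 0" if "n > 0" for n
    using h by (simp add: ip_move H2_def power_Suc[symmetric] del: power_Suc)
  then show ?thesis using h by (simp add: H2_def unimodular_mult_L2[OF unimodular_coord])
qed

lemma H2m_cconj_coord: "g \<in> H2m \<Longrightarrow> cconj coord * g \<in> H2m"
proof (rule H2mI)
  assume g: "g \<in> H2m"
  then show "cconj coord * g \<in> L2"
    using H2m_L2 unimodular_mult_L2[OF unimodular_cconj[OF unimodular_coord]] by blast
  fix n
  have "ip (cconj coord * g) (coord ^ n) = ip g (coord ^ Suc n)" by (simp add: ip_move)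
  then show "ip (cconj coord * g) (coord ^ n) = 0"
    using g coord_power_H2[of "Suc n"] by (simp add: H2m_def ominus_def)
qed

lemma cconj_H2m:
  assumes "g \<in> H2m" shows "cconj coord * cconj g \<in> H2"
proof -
  have "ip (cconj coord * cconj g) (cconj coord ^ n) = 0" if "n > 0" for n
  proof -
    have c: "coord ^ n = coord * coord ^ (n - 1)" using that by (metis Suc_pred' power_Suc)
    have "ip (cconj coord * cconj g) (cconj coord ^ n) = ip (coord ^ n) (coord * g)"
      by (simp add: ip_def mult_ac)
    also have "\<dots> = ip (coord ^ (n - 1)) g" unfolding c by (rule ip_unimodular[OF unimodular_coord])
    also have "\<dots> = cnj (ip g (coord ^ (n - 1)))" by (simp add: ip_cnj)
    also have "ip g (coord ^ (n - 1)) = 0" using assms coord_power_H2 by (simp add: H2m_def ominus_def)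
    finally show ?thesis by simp
  qed
  then show ?thesis
    using assms H2m_L2 by (auto simp: H2_def intro!: unimodular_mult_L2 unimodular_cconj unimodular_coord L2_cconj)
qed

lemma inner_functionD:
  assumes "inner_function \<theta>"
  shows "\<theta> \<in> H2" "unimodular \<theta>" "\<theta> \<in> Linf" "\<theta> \<in> L2" "\<theta> * cconj \<theta> = 1" "cconj \<theta> * \<theta> = 1"
  using assms unimodular_cancel H2_L2 unfolding inner_function_def by auto

text \<open>
  The function \<open>cconj (\<theta> * coord ^ n)\<close> has no Fourier coefficients of nonnegative index when \<open>n > 0\<close>, so
  it is orthogonal to \<open>h\<close>; this inner product is the Fourier coefficient of index \<open>-n\<close> of \<open>\<theta> * h\<close>.
\<close>

lemma inner_mult_H2:
  assumes th: "inner_function \<theta>" and h: "h \<in> H2" shows "\<theta> * h \<in> H2"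
proof -
  note th = inner_functionD[OF th]
  have "ip (\<theta> * h) (cconj coord ^ n) = 0" if n: "n > 0" for n
  proof -
    have "cconj \<theta> * cconj coord ^ n \<in> H2m"
    proof (rule H2mI)
      show "cconj \<theta> * cconj coord ^ n \<in> L2"
        by (intro unimodular_mult_L2 unimodular_cconj th coord_power_L2)
      fix m
      have "ip (cconj \<theta> * cconj coord ^ n) (coord ^ m) = cnj (ip \<theta> (cconj coord ^ (n + m)))"
        unfolding ip_cnj by (simp add: ip_def power_add mult_ac)
      then show "ip (cconj \<theta> * cconj coord ^ n) (coord ^ m) = 0" using th(1) n by (simp add: H2_def)
    qed
    then have "ip (cconj \<theta> * cconj coord ^ n) h = 0" using h by (simp add: H2m_def ominus_def)
    then show ?thesis unfolding ip_move[of \<theta>] by (subst ip_eq_0_commute)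
  qed
  then show ?thesis using h H2_L2 by (auto simp: H2_def intro: unimodular_mult_L2 th)
qed

lemma mulH2_ominus:
  assumes th: "inner_function \<theta>"
  shows "mulH2 \<theta> = L2 \<ominus> {\<theta> * cconj coord ^ n | n. n > 0}"
proof -
  note th = inner_functionD[OF th]
  show ?thesis
  proof safe
    fix f assume "f \<in> mulH2 \<theta>"
    then obtain h where "h \<in> H2" "f = \<theta> * h" by (auto simp: mulH2_def)
    then show "f \<in> L2 \<ominus> {\<theta> * cconj coord ^ n | n. n > 0}"
      using unimodular_mult_L2[OF th(2), of h] by (auto simp: ominus_def H2_def ip_unimodular[OF th(2)])
  next
    fix f assume f: "f \<in> L2 \<ominus> {\<theta> * cconj coord ^ n | n. n > 0}"
    then have "cconj \<theta> * f \<in> H2"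
      using unimodular_mult_L2[OF unimodular_cconj[OF th(2)], of f]
      by (auto simp: ominus_def H2_def ip_move)
    moreover have "f = \<theta> * (cconj \<theta> * f)" by (simp add: mult.assoc[symmetric] th)
    ultimately show "f \<in> mulH2 \<theta>" unfolding mulH2_def by blast
  qed
qed

lemma mulH2_gen_L2:
  assumes "inner_function \<theta>" shows "{\<theta> * cconj coord ^ n | n. P n} \<subseteq> L2"
  using unimodular_mult_L2[OF inner_functionD(2)[OF assms]] coord_power_L2 by auto

lemma mulH2_subset:
  assumes "inner_function \<theta>" shows "mulH2 \<theta> \<subseteq> H2" "mulH2 \<theta> \<subseteq> L2"
  using inner_mult_H2[OF assms] H2_L2 by (auto simp: mulH2_def)

lemma mulH2_I: "h \<in> H2 \<Longrightarrow> \<theta> * h \<in> mulH2 \<theta>"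
  by (auto simp: mulH2_def)

lemma inner_mem_mulH2: "\<theta> \<in> mulH2 \<theta>"
  using mulH2_I[OF coord_power_H2[of 0], of \<theta>] by simp

lemma mulH2_coord: "f \<in> mulH2 \<theta> \<Longrightarrow> coord * f \<in> mulH2 \<theta>"
  unfolding mulH2_def using H2_coord by (auto simp: mult.left_commute[of coord])

lemma mulH2_eq_0:
  assumes th: "inner_function \<theta>" and f: "f \<in> mulH2 \<theta>" and z: "\<And>n. ip f (\<theta> * coord ^ n) = 0"
  shows "f = 0"
proof -
  obtain h where h: "h \<in> H2" "f = \<theta> * h" using f by (auto simp: mulH2_def)
  then have "h = 0" using z by (intro H2_eq_0) (auto simp: ip_unimodular[OF inner_functionD(2)[OF th]])
  then show ?thesis using h by simp
qed

lemma Kperp_ominus: "Kperp \<theta> = L2 \<ominus> model_space \<theta>" "model_space \<theta> \<subseteq> L2"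
  using H2_L2 by (auto simp: Kperp_def model_space_def ominus_def)

lemma Kperp_L2: "Kperp \<theta> \<subseteq> L2"
  by (auto simp: Kperp_def ominus_def)

lemma mulH2_Kperp: "inner_function \<theta> \<Longrightarrow> mulH2 \<theta> \<subseteq> Kperp \<theta>"
  using mulH2_subset(2)[of \<theta>] by (fastforce simp: Kperp_def model_space_def ominus_def ip_eq_0_commute)

lemma H2m_Kperp: "H2m \<subseteq> Kperp \<theta>"
  by (auto simp: Kperp_def model_space_def ominus_def H2m_def)

text \<open>
  The vectors \<open>\<theta> * coord ^ n\<close> and \<open>cconj coord ^ (n + 1)\<close> are total in \<open>Kperp \<theta>\<close>: orthogonality to the latter
  puts \<open>f\<close> into \<open>H2\<close>, orthogonality to the former then into the model space, which is orthogonal to \<open>f\<close>.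
\<close>

lemma Kperp_eq_0:
  assumes th: "inner_function \<theta>" and f: "f \<in> Kperp \<theta>"
    and a: "\<And>n. ip f (\<theta> * coord ^ n) = 0" and b: "\<And>n. n > 0 \<Longrightarrow> ip f (cconj coord ^ n) = 0"
  shows "f = 0"
proof (rule l2norm_eq_0)
  show fL: "f \<in> L2" using f Kperp_L2 by blast
  then have fH: "f \<in> H2" using b by (simp add: H2_def)
  have p: "proj (mulH2 \<theta>) f \<in> mulH2 \<theta>" "\<And>h. h \<in> mulH2 \<theta> \<Longrightarrow> ip (proj (mulH2 \<theta>) f) h = ip f h"
    using proj_ominus[OF mulH2_gen_L2[OF th] fL] unfolding mulH2_ominus[OF th] by auto
  have "proj (mulH2 \<theta>) f = 0"
    using p a mulH2_I[OF coord_power_H2] by (intro mulH2_eq_0[OF th]) auto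
  then have "ip f h = 0" if "h \<in> mulH2 \<theta>" for h using p(2)[OF that] by simp
  then have "f \<in> model_space \<theta>" using fH by (simp add: model_space_def ominus_def)
  then show "ip f f = 0" using f by (simp add: Kperp_def ominus_def)
qed

lemma orthocomplement_mulH2: "inner_function \<theta> \<Longrightarrow> orthocomplement (mulH2 \<theta>)"
  unfolding orthocomplement_def using mulH2_ominus mulH2_gen_L2 by blast

lemma orthocomplement_H2m: "orthocomplement H2m"
  unfolding orthocomplement_def using H2m_def H2_L2 by blast

lemma orthocomplement_Kperp: "orthocomplement (Kperp \<theta>)"
  unfolding orthocomplement_def using Kperp_ominus by blast

lemma mulH2_orth: "inner_function \<theta> \<Longrightarrow> f \<in> mulH2 \<theta> \<Longrightarrow> n > 0 \<Longrightarrow> ip f (\<theta> * cconj coord ^ n) = 0"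
  using mulH2_ominus by (auto simp: ominus_def)

lemma analytic_poly_H2: "p \<in> analytic_poly \<Longrightarrow> p \<in> H2"
  unfolding H2_ominus
  by (induction rule: analytic_poly.induct)
    (auto intro!: ominus_add ominus_cscale coord_powers_subset_L2 coord_power_H2[unfolded H2_ominus])

lemma cconj_H2m_H2: "g \<in> H2m \<Longrightarrow> cconj g \<in> H2"
  using H2_coord[OF cconj_H2m, of g] by (simp add: mult.assoc[symmetric] unimodular_cancel unimodular_coord)

section \<open>Operator identities as invariance properties of a form\<close>

locale Kperp_operator =
  fixes \<theta> \<alpha> :: circle_fun and D :: "circle_fun \<Rightarrow> circle_fun"
  assumes \<theta>: "inner_function \<theta>" and \<alpha>: "inner_function \<alpha>"
    and D: "D \<in> bounded_ops (Kperp \<theta>) (Kperp \<alpha>)"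
begin

lemmas \<theta>D = inner_functionD[OF \<theta>] and \<alpha>D = inner_functionD[OF \<alpha>]
lemmas orthocomplements = orthocomplement_mulH2[OF \<theta>] orthocomplement_mulH2[OF \<alpha>] orthocomplement_H2m
  orthocomplement_Kperp

lemma D_L2: "f \<in> Kperp \<theta> \<Longrightarrow> D f \<in> L2"
  using D Kperp_L2 unfolding bounded_ops_def by blast

lemma mulH2_in_Kperp: "f \<in> mulH2 \<theta> \<Longrightarrow> f \<in> Kperp \<theta>" "f \<in> mulH2 \<alpha> \<Longrightarrow> f \<in> Kperp \<alpha>"
  using mulH2_Kperp \<theta> \<alpha> by blast+

lemma H2m_in_Kperp: "f \<in> H2m \<Longrightarrow> f \<in> Kperp \<beta>"
  using H2m_Kperp by blast

lemmas D_L2' = D_L2[OF mulH2_in_Kperp(1)] D_L2[OF H2m_in_Kperp]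

lemma in_L2: "f \<in> mulH2 \<theta> \<Longrightarrow> f \<in> L2" "f \<in> mulH2 \<alpha> \<Longrightarrow> f \<in> L2" "f \<in> H2m \<Longrightarrow> f \<in> L2" "f \<in> Kperp \<beta> \<Longrightarrow> f \<in> L2"
  using orthocomplements orthocomplement_L2 by blast+

lemma proj_D_bounded: "proj (mulH2 \<alpha>) \<circ> D \<in> bounded_ops (mulH2 \<theta>) L2" "proj (mulH2 \<alpha>) \<circ> D \<in> bounded_ops H2m L2"
  using D orthocomplement_proj_comp_bounded[OF orthocomplements(2) _ Kperp_L2] bounded_ops_mono mulH2_Kperp[OF \<theta>] H2m_Kperp by blast+

lemma coord_L2: "f \<in> L2 \<Longrightarrow> coord * f \<in> L2" "f \<in> L2 \<Longrightarrow> cconj coord * f \<in> L2"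
  by (intro unimodular_mult_L2 unimodular_cconj unimodular_coord; assumption)+

lemma That_coord: "inner_function \<beta> \<Longrightarrow> f \<in> mulH2 \<beta> \<Longrightarrow> That \<beta> coord f = coord * f"
  by (simp add: That_def Mul_def orthocomplement_proj_id[OF orthocomplement_mulH2] mulH2_coord)

text \<open>
  In this and the following equivalences an identity between vectors of a closed subspace is tested against all of its
  elements, where projections disappear and adjoints and multiplications move to the other
  argument. With multiplication by a fixed function in place of \<open>D\<close>, the two sides of the
  resulting identity are integrals of the same function.
\<close>

lemma shift_invariance_iff:
  "eq_on (mulH2 \<theta>) (proj (mulH2 \<alpha>) \<circ> D) (That \<alpha> (cconj coord) \<circ> (proj (mulH2 \<alpha>) \<circ> D) \<circ> That \<theta> coord)
    \<longleftrightarrow> (\<forall>f\<in>mulH2 \<theta>. \<forall>g\<in>mulH2 \<alpha>. ip (D f) g = ip (D (coord * f)) (coord * g))"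
  unfolding eq_on_def
proof (intro ball_cong refl)
  fix f assume f: "f \<in> mulH2 \<theta>"
  note L = D_L2'(1)[OF f] D_L2'(1)[OF mulH2_coord[OF f]]
  have "(proj (mulH2 \<alpha>) \<circ> D) f = (That \<alpha> (cconj coord) \<circ> (proj (mulH2 \<alpha>) \<circ> D) \<circ> That \<theta> coord) f
      \<longleftrightarrow> proj (mulH2 \<alpha>) (D f) = proj (mulH2 \<alpha>) (cconj coord * proj (mulH2 \<alpha>) (D (coord * f)))"
    using That_coord[OF \<theta> f] by (simp add: That_def Mul_def)
  also have "\<dots> \<longleftrightarrow> (\<forall>g\<in>mulH2 \<alpha>. ip (D f) g = ip (cconj coord * proj (mulH2 \<alpha>) (D (coord * f))) g)"
    by (rule orthocomplement_proj_eq_proj_iff[OF orthocomplements(2) L(1) coord_L2(2)[OF in_L2(2)[OF orthocomplement_proj_in[OF orthocomplements(2) L(2)]]]])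
  also have "\<dots> \<longleftrightarrow> (\<forall>g\<in>mulH2 \<alpha>. ip (D f) g = ip (D (coord * f)) (coord * g))"
    using L by (simp add: ip_move[of "cconj coord"] orthocomplement_ip_proj orthocomplements mulH2_coord)
  finally show "(proj (mulH2 \<alpha>) \<circ> D) f = (That \<alpha> (cconj coord) \<circ> (proj (mulH2 \<alpha>) \<circ> D) \<circ> That \<theta> coord) f
      \<longleftrightarrow> (\<forall>g\<in>mulH2 \<alpha>. ip (D f) g = ip (D (coord * f)) (coord * g))" .
qed

text \<open>
  Conjugation composed with multiplication by \<open>cconj coord\<close> exchanges \<open>H2m\<close> and \<open>H2\<close>, which sends the pair
  of arguments in the block \<open>H2m \<times> H2m\<close> to a pair in \<open>mulH2 \<theta> \<times> mulH2 \<alpha>\<close>, in reversed order.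
\<close>

lemma flip_in_mulH2:
  assumes "g \<in> H2m"
  shows "\<theta> * (\<alpha> * (cconj coord * cconj g)) \<in> mulH2 \<theta>" "\<theta> * (\<alpha> * (cconj coord * cconj g)) \<in> mulH2 \<alpha>"
  using mulH2_I[OF inner_mult_H2[OF \<alpha> cconj_H2m[OF assms]], of \<theta>]
    mulH2_I[OF inner_mult_H2[OF \<theta> cconj_H2m[OF assms]], of \<alpha>] by (simp_all add: mult_ac)

lemma reflection_symmetry_iff:
  "eq_on H2m (proj H2m \<circ> D)
     ((proj H2m \<circ> Conj \<alpha> \<circ> Mul (cconj \<theta>)) \<circ> adj (mulH2 \<theta>) (proj (mulH2 \<alpha>) \<circ> D) \<circ> (Mul \<theta> \<circ> Conj \<alpha>))
   \<longleftrightarrow> (\<forall>f\<in>H2m. \<forall>g\<in>H2m. ip (D f) g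
        = ip (D (\<theta> * (\<alpha> * (cconj coord * cconj g)))) (\<theta> * (\<alpha> * (cconj coord * cconj f))))"
  unfolding eq_on_def
proof (intro ball_cong refl)
  fix f assume f: "f \<in> H2m"
  define f' where "f' = \<theta> * (\<alpha> * (cconj coord * cconj f))"
  define w where "w = adj (mulH2 \<theta>) (proj (mulH2 \<alpha>) \<circ> D) f'"
  have f': "f' \<in> mulH2 \<alpha>" unfolding f'_def using f by (rule flip_in_mulH2)
  have w: "w \<in> mulH2 \<theta>" and ip_w: "\<And>k. k \<in> mulH2 \<theta> \<Longrightarrow> ip k w = ip (D k) f'"
    using orthocomplement_adj[OF orthocomplements(1) proj_D_bounded(1) order_refl in_L2(2)[OF f']] f' by (auto simp: w_def orthocomplement_ip_proj orthocomplements D_L2')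
  have "\<alpha> * cconj coord * cconj (cconj \<theta> * w) \<in> L2"
    by (intro unimodular_mult_L2 unimodular_mult L2_cconj unimodular_cconj unimodular_coord \<alpha>D \<theta>D in_L2(1) w)
  then have "proj H2m (D f) = proj H2m (\<alpha> * cconj coord * cconj (cconj \<theta> * w))
      \<longleftrightarrow> (\<forall>g\<in>H2m. ip (D f) g = ip (\<alpha> * cconj coord * cconj (cconj \<theta> * w)) g)"
    using f by (intro orthocomplement_proj_eq_proj_iff orthocomplements D_L2')
  also have "\<dots> \<longleftrightarrow> (\<forall>g\<in>H2m. ip (D f) g = ip (\<theta> * (\<alpha> * (cconj coord * cconj g))) w)"
    by (simp add: ip_def mult_ac)
  also have "\<dots> \<longleftrightarrow> (\<forall>g\<in>H2m. ip (D f) g = ip (D (\<theta> * (\<alpha> * (cconj coord * cconj g)))) f')"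
    by (simp add: ip_w flip_in_mulH2)
  finally show "(proj H2m \<circ> D) f = ((proj H2m \<circ> Conj \<alpha> \<circ> Mul (cconj \<theta>)) \<circ>
        adj (mulH2 \<theta>) (proj (mulH2 \<alpha>) \<circ> D) \<circ> (Mul \<theta> \<circ> Conj \<alpha>)) f
      \<longleftrightarrow> (\<forall>g\<in>H2m. ip (D f) g
        = ip (D (\<theta> * (\<alpha> * (cconj coord * cconj g)))) (\<theta> * (\<alpha> * (cconj coord * cconj f))))"
    by (simp add: Conj_def Mul_def w_def f'_def mult.assoc)
qed

lemma row_shift_iff:
  "eq_on (mulH2 \<theta>) ((proj H2m \<circ> D) \<circ> That \<theta> coord) (Tcheck coord \<circ> (proj H2m \<circ> D))
   \<longleftrightarrow> (\<forall>f\<in>mulH2 \<theta>. \<forall>g\<in>H2m. ip (D (coord * f)) g = ip (D f) (cconj coord * g))"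
  unfolding eq_on_def
proof (intro ball_cong refl)
  fix f assume f: "f \<in> mulH2 \<theta>"
  note L = D_L2'(1)[OF f] D_L2'(1)[OF mulH2_coord[OF f]]
  have "proj H2m (D (coord * f)) = proj H2m (coord * proj H2m (D f))
      \<longleftrightarrow> (\<forall>g\<in>H2m. ip (D (coord * f)) g = ip (coord * proj H2m (D f)) g)"
    by (rule orthocomplement_proj_eq_proj_iff[OF orthocomplements(3) L(2) coord_L2(1)[OF in_L2(3)[OF orthocomplement_proj_in[OF orthocomplements(3) L(1)]]]])
  also have "\<dots> \<longleftrightarrow> (\<forall>g\<in>H2m. ip (D (coord * f)) g = ip (D f) (cconj coord * g))"
    using L by (simp add: ip_move[of "coord"] orthocomplement_ip_proj orthocomplements H2m_cconj_coord)
  finally show "((proj H2m \<circ> D) \<circ> That \<theta> coord) f = (Tcheck coord \<circ> (proj H2m \<circ> D)) f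
      \<longleftrightarrow> (\<forall>g\<in>H2m. ip (D (coord * f)) g = ip (D f) (cconj coord * g))"
    using That_coord[OF \<theta> f] by (simp add: Tcheck_def Mul_def)
qed

lemma column_shift_iff:
  "eq_on (mulH2 \<alpha>) (adj H2m (proj (mulH2 \<alpha>) \<circ> D) \<circ> That \<alpha> coord)
      (Tcheck coord \<circ> adj H2m (proj (mulH2 \<alpha>) \<circ> D))
   \<longleftrightarrow> (\<forall>g\<in>mulH2 \<alpha>. \<forall>f\<in>H2m. ip (D f) (coord * g) = ip (D (cconj coord * f)) g)"
  unfolding eq_on_def
proof (intro ball_cong refl)
  fix g assume g: "g \<in> mulH2 \<alpha>"
  let ?A = "adj H2m (proj (mulH2 \<alpha>) \<circ> D)"
  have A: "?A k \<in> H2m" "ip f (?A k) = ip (D f) k" if "k \<in> mulH2 \<alpha>" "f \<in> H2m" for f k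
    using orthocomplement_adj[OF orthocomplements(3) proj_D_bounded(2) order_refl in_L2(2)[OF that(1)]] that by (auto simp: orthocomplement_ip_proj orthocomplements D_L2')
  have A': "?A k \<in> H2m" if "k \<in> mulH2 \<alpha>" for k
    using orthocomplement_adj_in[OF orthocomplements(3) proj_D_bounded(2) order_refl in_L2(2)[OF that]] .
  have "?A (coord * g) = proj H2m (coord * ?A g) \<longleftrightarrow> (\<forall>f\<in>H2m. ip (coord * ?A g) f = ip (?A (coord * g)) f)"
    by (subst eq_commute, rule orthocomplement_proj_eq_iff) (intro orthocomplements coord_L2 in_L2(3) A' g mulH2_coord)+
  also have "\<dots> \<longleftrightarrow> (\<forall>f\<in>H2m. ip f (?A (coord * g)) = ip (cconj coord * f) (?A g))"
    unfolding ip_cnj_eq_iff[of "coord * ?A g"] ip_move[of "cconj coord"] by auto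
  also have "\<dots> \<longleftrightarrow> (\<forall>f\<in>H2m. ip (D f) (coord * g) = ip (D (cconj coord * f)) g)"
    using g by (simp add: A mulH2_coord H2m_cconj_coord)
  finally show "(?A \<circ> That \<alpha> coord) g = (Tcheck coord \<circ> ?A) g
     \<longleftrightarrow> (\<forall>f\<in>H2m. ip (D f) (coord * g) = ip (D (cconj coord * f)) g)"
    using That_coord[OF \<alpha> g] by (simp add: Tcheck_def Mul_def)
qed

abbreviation "D_adj_\<alpha> \<equiv> adj (Kperp \<theta>) D \<alpha>"

lemma D_adj_at_alpha: "D_adj_\<alpha> \<in> Kperp \<theta>" "f \<in> Kperp \<theta> \<Longrightarrow> ip f D_adj_\<alpha> = ip (D f) \<alpha>"
  using orthocomplement_adj[OF orthocomplements(4) D Kperp_L2 \<alpha>D(4)] by auto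

lemma theta_Kperp: "\<theta> \<in> Kperp \<theta>" using mulH2_in_Kperp(1)[OF inner_mem_mulH2] .

lemma conj_in_mulH2:
  assumes "g \<in> H2m"
  shows "\<theta> * (\<alpha> * cconj g) \<in> mulH2 \<theta>" "\<theta> * (\<alpha> * cconj g) \<in> mulH2 \<alpha>"
  using mulH2_I[OF inner_mult_H2[OF \<alpha> cconj_H2m_H2[OF assms]], of \<theta>]
    mulH2_I[OF inner_mult_H2[OF \<theta> cconj_H2m_H2[OF assms]], of \<alpha>] by (simp_all add: mult_ac)

lemma theta_row_iff:
  "proj H2m (D \<theta>) = proj H2m (\<theta> * \<alpha> * cconj D_adj_\<alpha>)
    \<longleftrightarrow> (\<forall>g\<in>H2m. ip (D \<theta>) g = ip (D (\<theta> * (\<alpha> * cconj g))) \<alpha>)"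
proof -
  have "proj H2m (D \<theta>) = proj H2m (\<theta> * \<alpha> * cconj D_adj_\<alpha>)
      \<longleftrightarrow> (\<forall>g\<in>H2m. ip (D \<theta>) g = ip (\<theta> * \<alpha> * cconj D_adj_\<alpha>) g)"
    by (intro orthocomplement_proj_eq_proj_iff orthocomplements D_L2 theta_Kperp unimodular_mult_L2 unimodular_mult \<theta>D \<alpha>D
      L2_cconj in_L2(4)[OF D_adj_at_alpha(1)])
  also have "\<dots> \<longleftrightarrow> (\<forall>g\<in>H2m. ip (D \<theta>) g = ip (\<theta> * (\<alpha> * cconj g)) D_adj_\<alpha>)"
    by (simp add: ip_def mult_ac)
  finally show ?thesis by (simp add: D_adj_at_alpha conj_in_mulH2 mulH2_in_Kperp)
qed

lemma alpha_column_iff: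
  "proj H2m D_adj_\<alpha> = proj H2m (\<theta> * \<alpha> * cconj (D \<theta>))
    \<longleftrightarrow> (\<forall>g\<in>H2m. ip (D g) \<alpha> = ip (D \<theta>) (\<theta> * (\<alpha> * cconj g)))"
proof -
  have "proj H2m D_adj_\<alpha> = proj H2m (\<theta> * \<alpha> * cconj (D \<theta>))
      \<longleftrightarrow> (\<forall>g\<in>H2m. ip D_adj_\<alpha> g = ip (\<theta> * \<alpha> * cconj (D \<theta>)) g)"
    by (intro orthocomplement_proj_eq_proj_iff orthocomplements unimodular_mult_L2 unimodular_mult \<theta>D \<alpha>D
      L2_cconj D_L2 theta_Kperp in_L2(4)[OF D_adj_at_alpha(1)])
  also have "\<dots> \<longleftrightarrow> (\<forall>g\<in>H2m. ip g D_adj_\<alpha> = ip (D \<theta>) (\<theta> * (\<alpha> * cconj g)))"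
    unfolding ip_cnj_eq_iff[of D_adj_\<alpha>] by (simp add: ip_def mult_ac)
  finally show ?thesis by (simp add: D_adj_at_alpha H2m_in_Kperp)
qed

section \<open>Recovering the symbol from matrix entries\<close>

lemma D_add: "f \<in> Kperp \<theta> \<Longrightarrow> g \<in> Kperp \<theta> \<Longrightarrow> D (f + g) = D f + D g"
  and D_cscale: "f \<in> Kperp \<theta> \<Longrightarrow> D (cscale c f) = cscale c (D f)"
  using D unfolding bounded_ops_def by blast+

lemma shifted_inner_in_mulH2: "\<theta> * coord ^ i \<in> mulH2 \<theta>" "\<alpha> * coord ^ i \<in> mulH2 \<alpha>"
  by (intro mulH2_I coord_power_H2)+

text \<open>
  The Brown-Halmos argument. By sesquilinearity the form of \<open>D\<close> on \<open>\<theta> * p\<close> and \<open>\<alpha> * p\<close> is the Toeplitz form of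
  \<open>cconj \<alpha> * \<theta> * \<phi>\<close> at the polynomial \<open>p\<close>, and multiplication by \<open>\<theta>\<close> or \<open>\<alpha>\<close> is isometric. Matrix entries are
  the right hypothesis here because a symbol that is only square integrable need not
  have square integrable products with all of \<open>mulH2 \<theta>\<close>.
\<close>

lemma toeplitz_symbol_bounded:
  assumes \<phi>: "\<phi> \<in> L2"
    and entries: "\<And>i j. ip (D (\<theta> * coord ^ i)) (\<alpha> * coord ^ j) = ip (\<phi> * (\<theta> * coord ^ i)) (\<alpha> * coord ^ j)"
  shows "\<phi> \<in> Linf"
proof -
  define \<psi> where "\<psi> = cconj \<alpha> * \<theta> * \<phi>"
  have uni: "unimodular (cconj \<alpha> * \<theta>)" by (intro unimodular_mult unimodular_cconj \<alpha>D \<theta>D)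
  have \<psi>: "\<psi> \<in> L2" unfolding \<psi>_def by (rule unimodular_mult_L2[OF uni \<phi>])
  have thp: "\<theta> * p \<in> Kperp \<theta>" if "p \<in> analytic_poly" for p
    using mulH2_in_Kperp(1)[OF mulH2_I[OF analytic_poly_H2[OF that]]] .
  have thL: "\<phi> * (\<theta> * p) \<in> L2" if "p \<in> analytic_poly" for p
    using Linf_mult_L2[OF Linf_mult[OF \<theta>D(3) analytic_poly_Linf[OF that]] \<phi>] by (simp add: mult.commute)
  have alL: "\<alpha> * p \<in> L2" if "p \<in> analytic_poly" for p
    using unimodular_mult_L2[OF \<alpha>D(2) analytic_poly_L2[OF that]] .
  have left: "ip (D (\<theta> * p)) (\<alpha> * coord ^ j) = ip (\<phi> * (\<theta> * p)) (\<alpha> * coord ^ j)"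
    if "p \<in> analytic_poly" for p j
    using that
  proof induction
    case (monom c n)
    then show ?case
      using entries[of n j] by (simp add: cscale_mult D_cscale mulH2_in_Kperp shifted_inner_in_mulH2 ip_cscale_left)
  next
    case (add p q)
    then show ?case
      using thL[OF add.hyps(1)] thL[OF add.hyps(2)]
      by (simp add: distrib_left D_add thp ip_add_left D_L2 alL coord_power_analytic_poly)
  qed
  have both: "ip (D (\<theta> * p)) (\<alpha> * q) = ip (\<phi> * (\<theta> * p)) (\<alpha> * q)"
    if p: "p \<in> analytic_poly" and "q \<in> analytic_poly" for p q
    using that(2)
  proof induction
    case (monom c n)
    then show ?case using left[OF p, of n] by (simp add: cscale_mult ip_cscale_right)
  next
    case (add q q')
    then show ?case
      using thL[OF p] thp[OF p] by (simp add: distrib_left ip_add_right D_L2 alL)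
  qed
  obtain C where C: "\<And>f. f \<in> Kperp \<theta> \<Longrightarrow> l2norm (D f) \<le> C * l2norm f"
    using D unfolding bounded_ops_def by blast
  have "AE w in circle_measure. cmod (rep \<psi> w) \<le> 2 * C"
  proof (rule bounded_of_toeplitz_form[OF \<psi>])
    fix p assume p: "p \<in> analytic_poly"
    have "ip (\<psi> * p) p = ip (\<phi> * (\<theta> * p)) (\<alpha> * p)" by (simp add: \<psi>_def ip_def mult_ac)
    also have "\<dots> = ip (D (\<theta> * p)) (\<alpha> * p)" using both[OF p p] by simp
    finally have "cmod (ip (\<psi> * p) p) \<le> l2norm (D (\<theta> * p)) * l2norm (\<alpha> * p)"
      using cauchy_schwarz[OF D_L2[OF thp[OF p]] alL[OF p]] by simp
    also have "\<dots> \<le> (C * l2norm (\<theta> * p)) * l2norm (\<alpha> * p)"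
      by (intro mult_right_mono C thp p l2norm_nonneg)
    also have "\<dots> = C * (l2norm p)\<^sup>2"
      by (simp add: l2norm_unimodular \<theta>D \<alpha>D power2_eq_square)
    finally show "cmod (ip (\<psi> * p) p) \<le> C * (l2norm p)\<^sup>2" .
  qed
  then have "\<psi> \<in> Linf" unfolding Linf_rep by blast
  then have "cconj (cconj \<alpha> * \<theta>) * \<psi> \<in> Linf"
    by (rule Linf_mult[OF unimodular_Linf[OF unimodular_cconj[OF uni]]])
  also have "cconj (cconj \<alpha> * \<theta>) * \<psi> = \<phi>"
    unfolding \<psi>_def by (simp only: mult.assoc[symmetric, of _ _ \<phi>] unimodular_cancel[OF uni] mult_1)
  finally show ?thesis .
qed

lemma form_on_mulH2:
  assumes "\<phi> \<in> Linf"
    and "\<And>i j. ip (D (\<theta> * coord ^ i)) (\<alpha> * coord ^ j) = ip (\<phi> * (\<theta> * coord ^ i)) (\<alpha> * coord ^ j)"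
    and "f \<in> mulH2 \<theta>" "g \<in> mulH2 \<alpha>"
  shows "ip (D f) g = ip (\<phi> * f) g"
proof (rule form_extends_from_total_sets[OF orthocomplements(1,2) _ assms(1) _ _ _ _ _ assms(3,4)])
  show "D \<in> bounded_ops (mulH2 \<theta>) L2"
    using D mulH2_Kperp[OF \<theta>] Kperp_L2 by (rule bounded_ops_mono)
  show "range (\<lambda>i. \<theta> * coord ^ i) \<subseteq> mulH2 \<theta>" "range (\<lambda>i. \<alpha> * coord ^ i) \<subseteq> mulH2 \<alpha>"
    using shifted_inner_in_mulH2 by auto
  show "f = 0" if "f \<in> mulH2 \<theta>" "\<And>g. g \<in> range (\<lambda>i. \<theta> * coord ^ i) \<Longrightarrow> ip f g = 0" for f
    by (rule mulH2_eq_0[OF \<theta> that(1)]) (rule that(2), blast)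
  show "f = 0" if "f \<in> mulH2 \<alpha>" "\<And>g. g \<in> range (\<lambda>i. \<alpha> * coord ^ i) \<Longrightarrow> ip f g = 0" for f
    by (rule mulH2_eq_0[OF \<alpha> that(1)]) (rule that(2), blast)
qed (use assms(2) in auto)

lemma form_on_Kperp:
  assumes \<phi>: "\<phi> \<in> Linf"
    and aa: "\<And>i j. ip (D (\<theta> * coord ^ i)) (\<alpha> * coord ^ j) = ip (\<phi> * (\<theta> * coord ^ i)) (\<alpha> * coord ^ j)"
    and am: "\<And>i n. n > 0 \<Longrightarrow> ip (D (\<theta> * coord ^ i)) (cconj coord ^ n) = ip (\<phi> * (\<theta> * coord ^ i)) (cconj coord ^ n)"
    and ma: "\<And>n j. n > 0 \<Longrightarrow> ip (D (cconj coord ^ n)) (\<alpha> * coord ^ j) = ip (\<phi> * cconj coord ^ n) (\<alpha> * coord ^ j)"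
    and mm: "\<And>m n. m > 0 \<Longrightarrow> n > 0 \<Longrightarrow> ip (D (cconj coord ^ m)) (cconj coord ^ n) = ip (\<phi> * cconj coord ^ m) (cconj coord ^ n)"
    and f: "f \<in> Kperp \<theta>" and g: "g \<in> Kperp \<alpha>"
  shows "ip (D f) g = ip (\<phi> * f) g"
proof (rule form_extends_from_total_sets[OF orthocomplements(4,4) _ \<phi> _ _ _ _ _ f g])
  let ?S = "\<lambda>\<beta>. range (\<lambda>i. \<beta> * coord ^ i) \<union> {cconj coord ^ n | n. n > 0}"
  show "D \<in> bounded_ops (Kperp \<theta>) L2"
    using D order_refl Kperp_L2 by (rule bounded_ops_mono)
  show "?S \<theta> \<subseteq> Kperp \<theta>" "?S \<alpha> \<subseteq> Kperp \<alpha>"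
    using shifted_inner_in_mulH2 mulH2_in_Kperp H2m_in_Kperp cconj_coord_power_H2m by auto
  show "f = 0" if "f \<in> Kperp \<theta>" "\<And>g. g \<in> ?S \<theta> \<Longrightarrow> ip f g = 0" for f
    by (rule Kperp_eq_0[OF \<theta> that(1)]) (rule that(2), blast)+
  show "f = 0" if "f \<in> Kperp \<alpha>" "\<And>g. g \<in> ?S \<alpha> \<Longrightarrow> ip f g = 0" for f
    by (rule Kperp_eq_0[OF \<alpha> that(1)]) (rule that(2), blast)+
  show "ip (D f) g = ip (\<phi> * f) g" if "f \<in> ?S \<theta>" "g \<in> ?S \<alpha>" for f g
    using that aa am ma mm by auto
qed

lemma eq_on_adtt_iff:
  assumes "\<phi> \<in> Linf"
  shows "eq_on (Kperp \<theta>) D (adtt \<alpha> \<phi>) \<longleftrightarrow> (\<forall>f\<in>Kperp \<theta>. \<forall>g\<in>Kperp \<alpha>. ip (D f) g = ip (\<phi> * f) g)"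
  unfolding eq_on_def
proof (intro ball_cong refl)
  fix f assume f: "f \<in> Kperp \<theta>"
  have "D f \<in> Kperp \<alpha>" using D f by (auto simp: bounded_ops_def)
  then have "proj (Kperp \<alpha>) (\<phi> * f) = D f \<longleftrightarrow> (\<forall>g\<in>Kperp \<alpha>. ip (\<phi> * f) g = ip (D f) g)"
    using f by (intro orthocomplement_proj_eq_iff orthocomplements Linf_mult_L2 assms in_L2(4))
  then show "D f = adtt \<alpha> \<phi> f \<longleftrightarrow> (\<forall>g\<in>Kperp \<alpha>. ip (D f) g = ip (\<phi> * f) g)"
    by (auto simp: adtt_def Mul_def)
qed

text \<open>
  The defining identity holds on bounded functions, which include the total vectors
  \<open>\<theta> * coord ^ i\<close> and \<open>cconj coord ^ n\<close>.
\<close>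

lemma ADTT_symbol:
  assumes "D \<in> ADTT \<theta> \<alpha>"
  obtains \<phi> where "\<phi> \<in> Linf" "\<And>f g. f \<in> Kperp \<theta> \<Longrightarrow> g \<in> Kperp \<alpha> \<Longrightarrow> ip (D f) g = ip (\<phi> * f) g"
proof -
  obtain \<phi> where \<phi>: "\<phi> \<in> L2" "eq_on (Kperp \<theta> \<inter> Linf) D (adtt \<alpha> \<phi>)"
    using assms unfolding ADTT_def by blast
  have eq: "ip (D f) g = ip (\<phi> * f) g" if "f \<in> Kperp \<theta>" "f \<in> Linf" "g \<in> Kperp \<alpha>" for f g
  proof -
    have "\<phi> * f \<in> L2" using Linf_mult_L2[OF that(2) \<phi>(1)] by (simp add: mult.commute)
    moreover have "D f = proj (Kperp \<alpha>) (\<phi> * f)"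
      using \<phi>(2) that by (simp add: eq_on_def adtt_def Mul_def)
    ultimately show ?thesis using that by (simp add: orthocomplement_ip_proj orthocomplements)
  qed
  have gen: "\<theta> * coord ^ i \<in> Linf" "cconj coord ^ i \<in> Linf" for i
    by (intro unimodular_Linf unimodular_mult \<theta>D unimodular_coord_power)+
  have bdd: "\<phi> \<in> Linf"
    by (rule toeplitz_symbol_bounded[OF \<phi>(1)]) (intro eq gen shifted_inner_in_mulH2 mulH2_in_Kperp)
  show ?thesis
  proof (rule that[OF bdd], rule form_on_Kperp[OF bdd])
  qed (intro eq gen shifted_inner_in_mulH2 mulH2_in_Kperp H2m_in_Kperp cconj_coord_power_H2m; assumption)+
qed

text \<open>
  Multiplied by \<open>cconj \<alpha> * \<theta>\<close>, the first summand is the part of nonnegative frequencies of the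
  Fourier series, the second the part of nonpositive frequencies, and the third the constant term, which the
  first two both contain.
\<close>

definition symbol :: circle_fun where
  "symbol = cconj \<theta> * proj (mulH2 \<alpha>) (D \<theta>) + \<alpha> * cconj (proj (mulH2 \<theta>) D_adj_\<alpha>)
     - \<alpha> * cconj (cscale (ip D_adj_\<alpha> \<theta>) \<theta>)"

lemma symbol_L2: "symbol \<in> L2"
  unfolding symbol_def
  by (intro L2_add L2_diff unimodular_mult_L2 unimodular_cconj \<theta>D \<alpha>D L2_cconj L2_cscale in_L2(2)[OF orthocomplement_proj_in]
      in_L2(1)[OF orthocomplement_proj_in] orthocomplements D_L2 theta_Kperp in_L2(4)[OF D_adj_at_alpha(1)])

lemma ip_coord_power_one: "n > 0 \<Longrightarrow> ip (coord ^ n) 1 = 0" "n > 0 \<Longrightarrow> ip 1 (coord ^ n) = 0"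
  using circle_integral_power[of n] ip_eq_0_commute[of 1 "coord ^ n"] by (simp_all add: ip_def)

lemma ip_one_one: "ip 1 1 = 1"
proof -
  have "(l2norm 1)\<^sup>2 = integral\<^sup>L circle_measure (\<lambda>w. 1)"
    unfolding l2norm_rep by (rule integral_cong_AE) (use rep_one in \<open>auto elim: eventually_mono\<close>)
  then show ?thesis
    by (simp add: l2norm_ip measure_def space_circle_measure emeasure_circle_measure_UNIV flip: of_real_power)
qed

text \<open>
  By stationarity it is enough to treat the first row and the first column. Entries of the first row see
  only the coefficients contributed by \<open>D \<theta>\<close>, entries of the first column only those
  contributed by the adjoint at \<open>\<alpha>\<close>; in the corner both contribute the same number, which is also the
  contribution of the subtracted term.
\<close>

lemma symbol_entries:
  assumes stationary: "\<And>f g. f \<in> mulH2 \<theta> \<Longrightarrow> g \<in> mulH2 \<alpha> \<Longrightarrow> ip (D f) g = ip (D (coord * f)) (coord * g)"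
  shows "ip (D (\<theta> * coord ^ i)) (\<alpha> * coord ^ j) = ip (symbol * (\<theta> * coord ^ i)) (\<alpha> * coord ^ j)"
proof -
  define a where "a = proj (mulH2 \<alpha>) (D \<theta>)"
  define u where "u = proj (mulH2 \<theta>) D_adj_\<alpha>"
  define c where "c = ip D_adj_\<alpha> \<theta>"
  have a: "a \<in> mulH2 \<alpha>" "\<And>g. g \<in> mulH2 \<alpha> \<Longrightarrow> ip a g = ip (D \<theta>) g"
    unfolding a_def by (simp_all add: orthocomplements orthocomplement_proj_in orthocomplement_ip_proj D_L2 theta_Kperp)
  have u: "u \<in> mulH2 \<theta>" "\<And>f. f \<in> mulH2 \<theta> \<Longrightarrow> ip f u = ip (D f) \<alpha>"
    unfolding u_def using in_L2(4)[OF D_adj_at_alpha(1)]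
    by (simp_all add: orthocomplements orthocomplement_proj_in orthocomplement_ip_proj' D_adj_at_alpha mulH2_in_Kperp)
  have c: "cnj c = ip (D \<theta>) \<alpha>"
    using D_adj_at_alpha(2)[OF theta_Kperp] by (simp add: c_def ip_cnj)
  \<comment> \<open>Contribution of the three summands of \<open>symbol\<close> to a matrix entry.\<close>
  have split: "ip (symbol * (\<theta> * coord ^ i)) (\<alpha> * coord ^ j)
      = ip (coord ^ i * a) (\<alpha> * coord ^ j) + ip (\<theta> * coord ^ i * cconj coord ^ j) u
        - cnj c * ip (coord ^ i) (coord ^ j)" for i j
  proof -
    have e: "symbol * (\<theta> * coord ^ i)
        = (cconj \<theta> * \<theta>) * (coord ^ i * a) + \<alpha> * (\<theta> * coord ^ i * cconj u)
          - cscale (cnj c) (\<alpha> * (coord ^ i * (cconj \<theta> * \<theta>)))"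
      unfolding symbol_def a_def[symmetric] u_def[symmetric] c_def[symmetric]
      by (simp add: algebra_simps cscale_mult)
    have L: "coord ^ i * a \<in> L2" "\<alpha> * (\<theta> * coord ^ i * cconj u) \<in> L2"
      "cscale (cnj c) (\<alpha> * coord ^ i) \<in> L2" "\<alpha> * coord ^ j \<in> L2"
      by (intro unimodular_mult_L2 unimodular_mult unimodular_coord_power \<theta>D \<alpha>D
        L2_cconj L2_cscale coord_power_L2 in_L2(2)[OF a(1)] in_L2(1)[OF u(1)])+
    have "ip (symbol * (\<theta> * coord ^ i)) (\<alpha> * coord ^ j)
        = ip (coord ^ i * a) (\<alpha> * coord ^ j) + ip (\<alpha> * (\<theta> * coord ^ i * cconj u)) (\<alpha> * coord ^ j)
          - cnj c * ip (\<alpha> * coord ^ i) (\<alpha> * coord ^ j)"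
      unfolding e \<theta>D(6) using L by (simp add: ip_add_left ip_diff_left L2_add ip_cscale_left)
    also have "ip (\<alpha> * (\<theta> * coord ^ i * cconj u)) (\<alpha> * coord ^ j) = ip (\<theta> * coord ^ i * cconj coord ^ j) u"
      unfolding ip_unimodular[OF \<alpha>D(2)] by (simp add: ip_def mult_ac)
    finally show ?thesis by (simp add: ip_unimodular[OF \<alpha>D(2)])
  qed
  have row: "ip (D \<theta>) (\<alpha> * coord ^ j) = ip (symbol * (\<theta> * coord ^ 0)) (\<alpha> * coord ^ j)" for j
  proof (cases "j = 0")
    case True
    then show ?thesis unfolding split
      using c a(2)[OF inner_mem_mulH2] u(2)[OF inner_mem_mulH2]
      by (simp add: ip_one_one)
  next
    case False
    then have "ip (\<theta> * cconj coord ^ j) u = 0"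
      using mulH2_orth[OF \<theta> u(1), of j] by (simp add: ip_eq_0_commute)
    then show ?thesis unfolding split
      using False a(2)[OF shifted_inner_in_mulH2(2)] by (simp add: ip_coord_power_one)
  qed
  have col: "ip (D (\<theta> * coord ^ i)) \<alpha> = ip (symbol * (\<theta> * coord ^ i)) (\<alpha> * coord ^ 0)" if "i > 0" for i
  proof -
    have "ip (coord ^ i * a) \<alpha> = ip a (\<alpha> * cconj coord ^ i)" by (simp add: ip_def mult_ac)
    also have "\<dots> = 0" using mulH2_orth[OF \<alpha> a(1) that] .
    finally show ?thesis unfolding split
      using that u(2)[OF shifted_inner_in_mulH2(1)] by (simp add: ip_coord_power_one)
  qed
  show ?thesis
  proof (induction i arbitrary: j)
    case 0
    then show ?case using row[of j] by simp
  next
    case (Suc i)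
    show ?case
    proof (cases j)
      case 0
      then show ?thesis using col[of "Suc i"] by simp
    next
      case (Suc k)
      have "ip (D (\<theta> * coord ^ Suc i)) (\<alpha> * coord ^ Suc k) = ip (D (\<theta> * coord ^ i)) (\<alpha> * coord ^ k)"
        using stationary[OF shifted_inner_in_mulH2, of i k] by (simp add: mult_ac)
      also have "\<dots> = ip (symbol * (\<theta> * coord ^ i)) (\<alpha> * coord ^ k)" by (rule Suc.IH)
      also have "\<dots> = ip (symbol * (\<theta> * coord ^ Suc i)) (\<alpha> * coord ^ Suc k)"
        using ip_unimodular[OF unimodular_coord, of "symbol * (\<theta> * coord ^ i)" "\<alpha> * coord ^ k"]
        by (simp add: mult_ac)
      finally show ?thesis using Suc by simp
    qed
  qed
qed

text \<open>
  The invariances that correspond to the four conditions, for an arbitrary multiplier: both sides are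
  integrals of the same function because \<open>\<theta>\<close>, \<open>\<alpha>\<close> and \<open>coord\<close> are unimodular.
\<close>

lemma symbol_form_identities:
  "ip (\<phi> * (coord * f)) (coord * g) = ip (\<phi> * f) g"
  "ip (\<phi> * (\<theta> * (\<alpha> * (cconj coord * cconj g)))) (\<theta> * (\<alpha> * (cconj coord * cconj f))) = ip (\<phi> * f) g"
  "ip (\<phi> * (coord * f)) g = ip (\<phi> * f) (cconj coord * g)"
  "ip (\<phi> * (cconj coord * f)) g = ip (\<phi> * f) (coord * g)"
  "ip (\<phi> * (\<theta> * (\<alpha> * cconj g))) \<alpha> = ip (\<phi> * \<theta>) g"
  "ip (\<phi> * \<theta>) (\<theta> * (\<alpha> * cconj g)) = ip (\<phi> * g) \<alpha>"
proof -
  note uni = ip_unimodular[OF \<theta>D(2)] ip_unimodular[OF \<alpha>D(2)] ip_unimodular[OF unimodular_coord]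
    ip_unimodular[OF unimodular_cconj[OF unimodular_coord]]
  show "ip (\<phi> * (coord * f)) (coord * g) = ip (\<phi> * f) g"
    by (simp only: mult.left_commute[of \<phi> coord] uni)
  have "ip (\<phi> * (\<theta> * (\<alpha> * (cconj coord * cconj g)))) (\<theta> * (\<alpha> * (cconj coord * cconj f)))
      = ip (\<phi> * cconj g) (cconj f)"
    by (simp only: mult.left_commute[of \<phi> \<theta>] mult.left_commute[of \<phi> \<alpha>] mult.left_commute[of \<phi> "cconj coord"] uni)
  then show "ip (\<phi> * (\<theta> * (\<alpha> * (cconj coord * cconj g)))) (\<theta> * (\<alpha> * (cconj coord * cconj f))) = ip (\<phi> * f) g"
    by (simp add: ip_def mult_ac)
  show "ip (\<phi> * (coord * f)) g = ip (\<phi> * f) (cconj coord * g)"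
    "ip (\<phi> * (cconj coord * f)) g = ip (\<phi> * f) (coord * g)"
    by (simp_all add: ip_def mult_ac)
  have "ip (\<phi> * (\<theta> * (\<alpha> * cconj g))) \<alpha> = ip (\<alpha> * (\<phi> * \<theta> * cconj g)) (\<alpha> * 1)"
    by (simp add: mult_ac)
  then show "ip (\<phi> * (\<theta> * (\<alpha> * cconj g))) \<alpha> = ip (\<phi> * \<theta>) g"
    unfolding uni by (simp add: ip_def)
  have "ip (\<phi> * \<theta>) (\<theta> * (\<alpha> * cconj g)) = ip (\<theta> * \<phi>) (\<theta> * (\<alpha> * cconj g))"
    by (simp add: mult_ac)
  then show "ip (\<phi> * \<theta>) (\<theta> * (\<alpha> * cconj g)) = ip (\<phi> * g) \<alpha>"
    unfolding uni by (simp add: ip_def mult_ac)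
qed

section \<open>The characterization\<close>

text \<open>
  The hypothesis \<open>shift\<close> gives the symbol and the block \<open>mulH2 \<theta> \<times> mulH2 \<alpha>\<close>. The hypotheses \<open>reflection\<close>,
  \<open>theta_row\<close> and \<open>alpha_column\<close> express \<open>H2m \<times> H2m\<close>, the row of \<open>\<theta>\<close> and the column of \<open>\<alpha>\<close> by values of the
  form on that block, and \<open>row_shift\<close> and \<open>column_shift\<close> propagate row and column by induction.
\<close>

lemma symbol_represents:
  assumes shift: "\<And>f g. f \<in> mulH2 \<theta> \<Longrightarrow> g \<in> mulH2 \<alpha> \<Longrightarrow> ip (D f) g = ip (D (coord * f)) (coord * g)"
    and reflection: "\<And>f g. f \<in> H2m \<Longrightarrow> g \<in> H2m \<Longrightarrow> ip (D f) g
        = ip (D (\<theta> * (\<alpha> * (cconj coord * cconj g)))) (\<theta> * (\<alpha> * (cconj coord * cconj f)))"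
    and row_shift: "\<And>f g. f \<in> mulH2 \<theta> \<Longrightarrow> g \<in> H2m \<Longrightarrow> ip (D (coord * f)) g = ip (D f) (cconj coord * g)"
    and column_shift: "\<And>f g. g \<in> mulH2 \<alpha> \<Longrightarrow> f \<in> H2m \<Longrightarrow> ip (D f) (coord * g) = ip (D (cconj coord * f)) g"
    and theta_row: "\<And>g. g \<in> H2m \<Longrightarrow> ip (D \<theta>) g = ip (D (\<theta> * (\<alpha> * cconj g))) \<alpha>"
    and alpha_column: "\<And>g. g \<in> H2m \<Longrightarrow> ip (D g) \<alpha> = ip (D \<theta>) (\<theta> * (\<alpha> * cconj g))"
  shows "symbol \<in> Linf" and "eq_on (Kperp \<theta>) D (adtt \<alpha> symbol)"
proof -
  note entries = symbol_entries[OF shift]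
  show bdd: "symbol \<in> Linf" by (rule toeplitz_symbol_bounded[OF symbol_L2 entries])
  note aa = form_on_mulH2[OF bdd entries]
  note identities = symbol_form_identities[of symbol]
  have mm: "ip (D f) g = ip (symbol * f) g" if "f \<in> H2m" "g \<in> H2m" for f g
    unfolding reflection[OF that] using that by (simp only: aa flip_in_mulH2 identities)
  have am0: "ip (D \<theta>) g = ip (symbol * \<theta>) g" if "g \<in> H2m" for g
    unfolding theta_row[OF that] using that by (simp only: aa conj_in_mulH2 inner_mem_mulH2 identities)
  have ma0: "ip (D f) \<alpha> = ip (symbol * f) \<alpha>" if "f \<in> H2m" for f
    unfolding alpha_column[OF that] using that by (simp only: aa conj_in_mulH2 inner_mem_mulH2 identities)
  have am: "ip (D (\<theta> * coord ^ i)) g = ip (symbol * (\<theta> * coord ^ i)) g" if "g \<in> H2m" for i g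
    using that
  proof (induction i arbitrary: g)
    case (Suc i)
    have "ip (D (\<theta> * coord ^ Suc i)) g = ip (D (\<theta> * coord ^ i)) (cconj coord * g)"
      using row_shift[OF shifted_inner_in_mulH2(1) Suc.prems, of i] by (simp add: mult_ac)
    also have "\<dots> = ip (symbol * (\<theta> * coord ^ i)) (cconj coord * g)"
      by (intro Suc H2m_cconj_coord)
    finally show ?case by (simp add: ip_def mult_ac)
  qed (simp add: am0)
  have ma: "ip (D f) (\<alpha> * coord ^ j) = ip (symbol * f) (\<alpha> * coord ^ j)" if "f \<in> H2m" for j f
    using that
  proof (induction j arbitrary: f)
    case (Suc j)
    have "ip (D f) (\<alpha> * coord ^ Suc j) = ip (D (cconj coord * f)) (\<alpha> * coord ^ j)"
      using column_shift[OF shifted_inner_in_mulH2(2) Suc.prems, of j] by (simp add: mult_ac)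
    also have "\<dots> = ip (symbol * (cconj coord * f)) (\<alpha> * coord ^ j)"
      by (intro Suc H2m_cconj_coord)
    finally show ?case by (simp add: ip_def mult_ac)
  qed (simp add: ma0)
  show "eq_on (Kperp \<theta>) D (adtt \<alpha> symbol)"
    unfolding eq_on_adtt_iff[OF bdd]
    by (intro ballI, rule form_on_Kperp[OF bdd entries am ma mm]) (auto intro: cconj_coord_power_H2m)
qed

lemma invariance_of_symbol_form:
  assumes form: "\<And>f g. f \<in> Kperp \<theta> \<Longrightarrow> g \<in> Kperp \<alpha> \<Longrightarrow> ip (D f) g = ip (\<phi> * f) g"
  shows "f \<in> mulH2 \<theta> \<Longrightarrow> g \<in> mulH2 \<alpha> \<Longrightarrow> ip (D f) g = ip (D (coord * f)) (coord * g)"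
    and "h \<in> H2m \<Longrightarrow> k \<in> H2m \<Longrightarrow> ip (D h) k
        = ip (D (\<theta> * (\<alpha> * (cconj coord * cconj k)))) (\<theta> * (\<alpha> * (cconj coord * cconj h)))"
    and "f \<in> mulH2 \<theta> \<Longrightarrow> h \<in> H2m \<Longrightarrow> ip (D (coord * f)) h = ip (D f) (cconj coord * h)"
    and "g \<in> mulH2 \<alpha> \<Longrightarrow> h \<in> H2m \<Longrightarrow> ip (D h) (coord * g) = ip (D (cconj coord * h)) g"
    and "h \<in> H2m \<Longrightarrow> ip (D \<theta>) h = ip (D (\<theta> * (\<alpha> * cconj h))) \<alpha>"
    and "h \<in> H2m \<Longrightarrow> ip (D h) \<alpha> = ip (D \<theta>) (\<theta> * (\<alpha> * cconj h))"
proof -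
  note mem = mulH2_in_Kperp H2m_in_Kperp mulH2_coord H2m_cconj_coord flip_in_mulH2 conj_in_mulH2 inner_mem_mulH2
  have cancel: "cconj coord * (coord * x) = x" for x
    by (simp add: mult.assoc[symmetric] unimodular_cancel unimodular_coord)
  show "f \<in> mulH2 \<theta> \<Longrightarrow> g \<in> mulH2 \<alpha> \<Longrightarrow> ip (D f) g = ip (D (coord * f)) (coord * g)"
    and "f \<in> mulH2 \<theta> \<Longrightarrow> h \<in> H2m \<Longrightarrow> ip (D (coord * f)) h = ip (D f) (cconj coord * h)"
    and "g \<in> mulH2 \<alpha> \<Longrightarrow> h \<in> H2m \<Longrightarrow> ip (D h) (coord * g) = ip (D (cconj coord * h)) g"
    and "h \<in> H2m \<Longrightarrow> ip (D \<theta>) h = ip (D (\<theta> * (\<alpha> * cconj h))) \<alpha>"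
    and "h \<in> H2m \<Longrightarrow> ip (D h) \<alpha> = ip (D \<theta>) (\<theta> * (\<alpha> * cconj h))"
    and "h \<in> H2m \<Longrightarrow> k \<in> H2m \<Longrightarrow> ip (D h) k
        = ip (D (\<theta> * (\<alpha> * (cconj coord * cconj k)))) (\<theta> * (\<alpha> * (cconj coord * cconj h)))"
    by (simp_all only: form mem symbol_form_identities cancel)
qed

end

theorem theorem3p4:
  fixes \<theta> \<alpha> :: circle_fun and D :: "circle_fun \<Rightarrow> circle_fun"
  assumes "inner_function \<theta>" and "inner_function \<alpha>"
    and "D \<in> bounded_ops (Kperp \<theta>) (Kperp \<alpha>)"
  shows
    "(D \<in> ADTT \<theta> \<alpha> \<longleftrightarrow>
       eq_on (mulH2 \<theta>) (proj (mulH2 \<alpha>) \<circ> D)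
         (That \<alpha> (cconj coord) \<circ> (proj (mulH2 \<alpha>) \<circ> D) \<circ> That \<theta> coord) \<and>
       eq_on H2m (proj H2m \<circ> D)
         ((proj H2m \<circ> Conj \<alpha> \<circ> Mul (cconj \<theta>)) \<circ> adj (mulH2 \<theta>) (proj (mulH2 \<alpha>) \<circ> D)
            \<circ> (Mul \<theta> \<circ> Conj \<alpha>)) \<and>
       (eq_on (mulH2 \<theta>) ((proj H2m \<circ> D) \<circ> That \<theta> coord) (Tcheck coord \<circ> (proj H2m \<circ> D)) \<and>
        eq_on (mulH2 \<alpha>) (adj H2m (proj (mulH2 \<alpha>) \<circ> D) \<circ> That \<alpha> coord)
          (Tcheck coord \<circ> adj H2m (proj (mulH2 \<alpha>) \<circ> D))) \<and>
       (proj H2m (D \<theta>) = proj H2m (\<theta> * \<alpha> * cconj (adj (Kperp \<theta>) D \<alpha>)) \<and>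
        proj H2m (adj (Kperp \<theta>) D \<alpha>) = proj H2m (\<theta> * \<alpha> * cconj (D \<theta>)))) \<and>
     (D \<in> ADTT \<theta> \<alpha> \<longrightarrow>
       (let \<phi> = cconj \<theta> * proj (mulH2 \<alpha>) (D \<theta>)
              + \<alpha> * cconj (proj (mulH2 \<theta>) (adj (Kperp \<theta>) D \<alpha>))
              - \<alpha> * cconj (cscale (ip (adj (Kperp \<theta>) D \<alpha>) \<theta>) \<theta>)
        in \<phi> \<in> Linf \<and> eq_on (Kperp \<theta>) D (adtt \<alpha> \<phi>)))"
proof -
  interpret Kperp_operator \<theta> \<alpha> D
    using assms by unfold_locales
  note iffs = shift_invariance_iff reflection_symmetry_iff row_shift_iff column_shift_iff theta_row_iff alpha_column_iff
  let ?form = "(\<forall>f\<in>mulH2 \<theta>. \<forall>g\<in>mulH2 \<alpha>. ip (D f) g = ip (D (coord * f)) (coord * g)) \<and>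
    (\<forall>f\<in>H2m. \<forall>g\<in>H2m. ip (D f) g
        = ip (D (\<theta> * (\<alpha> * (cconj coord * cconj g)))) (\<theta> * (\<alpha> * (cconj coord * cconj f)))) \<and>
    ((\<forall>f\<in>mulH2 \<theta>. \<forall>g\<in>H2m. ip (D (coord * f)) g = ip (D f) (cconj coord * g)) \<and>
     (\<forall>g\<in>mulH2 \<alpha>. \<forall>f\<in>H2m. ip (D f) (coord * g) = ip (D (cconj coord * f)) g)) \<and>
    ((\<forall>g\<in>H2m. ip (D \<theta>) g = ip (D (\<theta> * (\<alpha> * cconj g))) \<alpha>) \<and>
     (\<forall>g\<in>H2m. ip (D g) \<alpha> = ip (D \<theta>) (\<theta> * (\<alpha> * cconj g))))"
  have nec: ?form if "D \<in> ADTT \<theta> \<alpha>"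
  proof -
    obtain \<phi> where "\<phi> \<in> Linf" "\<And>f g. f \<in> Kperp \<theta> \<Longrightarrow> g \<in> Kperp \<alpha> \<Longrightarrow> ip (D f) g = ip (\<phi> * f) g"
      using ADTT_symbol[OF \<open>D \<in> ADTT \<theta> \<alpha>\<close>] by blast
    from invariance_of_symbol_form[OF this(2)] show ?thesis by (intro conjI ballI)
  qed
  have suf: "symbol \<in> Linf \<and> eq_on (Kperp \<theta>) D (adtt \<alpha> symbol)" if ?form
  proof -
    note c = that[THEN conjunct1] that[THEN conjunct2, THEN conjunct1]
      that[THEN conjunct2, THEN conjunct2, THEN conjunct1]
      that[THEN conjunct2, THEN conjunct2, THEN conjunct2]
    show ?thesis
      using symbol_represents[OF c(1)[rule_format] c(2)[rule_format] c(3)[THEN conjunct1, rule_format]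
        c(3)[THEN conjunct2, rule_format] c(4)[THEN conjunct1, rule_format] c(4)[THEN conjunct2, rule_format]]
      by (rule conjI)
  qed
  have "D \<in> ADTT \<theta> \<alpha>" if "symbol \<in> Linf \<and> eq_on (Kperp \<theta>) D (adtt \<alpha> symbol)"
    using that D symbol_L2 unfolding ADTT_def eq_on_def by blast
  then have "(D \<in> ADTT \<theta> \<alpha> \<longleftrightarrow> ?form) \<and>
      (D \<in> ADTT \<theta> \<alpha> \<longrightarrow> symbol \<in> Linf \<and> eq_on (Kperp \<theta>) D (adtt \<alpha> symbol))"
    using nec suf by argo
  then show ?thesis
    unfolding iffs symbol_def Let_def .
qed

end
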